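(* Let $\mathcal{A}$ be an additive strict monoidal category with biadditive tensor product $\circ$ and identity object $\mathbbm{1}$. Then the tensor product of pyramids and of morphisms of pyramids over $\mathcal{A}$, defined in the context, endows the category $\mathcal{P}(\mathcal{A})$ of pyramids over $\mathcal{A}$ with the structure of a strict monoidal category.
   Context: **Indices.** $\mathbb{I}$ is the abelian group of all $\mathbf{a}=(a_i)_{i\in\mathbb{N}}$ with $a_i\in\mathbb{Z}$ and $a_i=0$ for $i\gg0$ ($\mathbb{N}=\{1,2,\dots\}$); $\varepsilon_i\in\mathbb{I}$ is the $i$-th standard basis vector; $\mathrm{ht}(\mathbf{a})=\sum_i a_i$; $\mathbb{I}_k=\{\mathbf{a}\in\mathbb{I}:\mathrm{ht}(\mathbf{a})=k\}$. For $k\geq0$, $\pi_k(\mathbf{a})=(a_1,\dots,a_k,0,0,\dots)$ (so $\pi_0(\mathbf{a})=\mathbf{0}$) and $\sigma_k(\mathbf{a})=(a_{k+1},a_{k+2},\dots)$ (so $\sigma_0=\mathrm{id}$). **Pyramids.** A pyramid $(X_\bullet,d_\bullet,n)$ over $\mathcal{A}$ consists of $n\in\mathbb{Z}_{\geq0}$, objects $X_{\mathbf{a}}$ of $\mathcal{A}$ ($\mathbf{a}\in\mathbb{I}$) and morphisms $d_{\mathbf{a},i}:X_{\mathbf{a}}\to X_{\mathbf{a}+\varepsilon_i}$ ($i\in\mathbb{N}$) such that: (I) $X_{\mathbf{a}}=0$ unless $a_i=0$ for all $i>n$; (II) there is $m\in\mathbb{Z}$ with $X_{\mathbf{a}}=0$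 unless all $a_i<m$; (III) the composite of $d_{\mathbf{a},i}$ followed by $d_{\mathbf{a}+\varepsilon_i,i}$ is $0$; (IV) $d_{\mathbf{a},i}$ followed by $d_{\mathbf{a}+\varepsilon_i,j}$ equals minus $d_{\mathbf{a},j}$ followed by $d_{\mathbf{a}+\varepsilon_j,i}$. Let $d^{(k)}$ be the matrix with rows indexed by $\mathbf{a}\in\mathbb{I}_{k+1}$, columns by $\mathbf{b}\in\mathbb{I}_k$, and entries $d^{(k)}_{\mathbf{a},\mathbf{b}}=d_{\mathbf{b},i}$ if $\mathbf{a}=\mathbf{b}+\varepsilon_i$, and $0$ otherwise. A morphism $\alpha:(X_\bullet,d_\bullet,n)\to(Y_\bullet,\partial_\bullet,m)$ is a family of matrices $\alpha^{(k)}=(\alpha^{(k)}_{\mathbf{a},\mathbf{b}})_{\mathbf{a},\mathbf{b}\in\mathbb{I}_k}$, $k\in\mathbb{Z}$, with $\alpha^{(k)}_{\mathbf{a},\mathbf{b}}:X_{\mathbf{b}}\to Y_{\mathbf{a}}$, such that $\alpha^{(k+1)}\cdot d^{(k)}=\partial^{(k)}\cdot\alpha^{(k)}$ for all $k$. Composition is matrix multiplication for each $k$; identity morphisms are given by identity matrices. This gives the category $\mathcal{P}(\mathcal{A})$. **Convention.** Zero objects of $\mathcal{A}$ are identified with a single object $0$ (so $X_{\mathbf{a}}=0$ is an equality and $0\circ X=X\circ0=0$). **Tensor product.** $(X_\bullet,d_\bullet,n)\circ(Y_\bullet,\partial_\bullet,m):=(Z_\bullet,\daleth_\bullet,n+m)$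 with $Z_{\mathbf{a}}:=X_{\pi_n(\mathbf{a})}\circ Y_{\sigma_n(\mathbf{a})}$ and $\daleth_{\mathbf{a},i}:=d_{\pi_n(\mathbf{a}),i}\circ_0\mathrm{id}$ if $i\leq n$, $\daleth_{\mathbf{a},i}:=(-1)^{\mathrm{ht}(\pi_n(\mathbf{a}))}\,\mathrm{id}\circ_0\partial_{\sigma_n(\mathbf{a}),i-n}$ if $i>n$, where $\circ_0$ denotes the tensor product of morphisms in $\mathcal{A}$. For morphisms $\alpha:(X_\bullet,d_\bullet,n)\to(\tilde X_\bullet,\tilde d_\bullet,\tilde n)$ and $\beta:(Y_\bullet,\partial_\bullet,m)\to(\tilde Y_\bullet,\tilde\partial_\bullet,\tilde m)$, and $k\in\mathbb{Z}$, $\mathbf{a},\mathbf{b}\in\mathbb{I}_k$, $$(\alpha\circ_0\beta)^{(k)}_{\mathbf{a},\mathbf{b}}:=\begin{cases}\alpha^{(l)}_{\pi_{\tilde n}(\mathbf{a}),\pi_n(\mathbf{b})}\circ_0\beta^{(k-l)}_{\sigma_{\tilde n}(\mathbf{a}),\sigma_n(\mathbf{b})},&\text{if } l=\mathrm{ht}(\pi_{\tilde n}(\mathbf{a}))=\mathrm{ht}(\pi_n(\mathbf{b})),\\0,&\text{otherwise.}\end{cases}$$ *)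

theory Defs
  imports "HOL-Algebra.FiniteProduct" "HOL-Library.FuncSet" "HOL-Library.Poly_Mapping"
begin

section \<open>Categories, additive categories, strict monoidal categories\<close>

record ('o, 'm) cat =
  Obj :: "'o set"
  Arr :: "'m set"
  Dom :: "'m \<Rightarrow> 'o"
  Cod :: "'m \<Rightarrow> 'o"
  Ident :: "'o \<Rightarrow> 'm"
  Comp :: "'m \<Rightarrow> 'm \<Rightarrow> 'm" (infixr "\<cdot>\<index>" 70)

text \<open>Composition is in applicative order: \<open>g \<cdot> f\<close> is \<open>f\<close> followed by \<open>g\<close>.\<close>

definition Hom :: "('o, 'm, 'x) cat_scheme \<Rightarrow> 'o \<Rightarrow> 'o \<Rightarrow> 'm set"
  where "Hom C X Y = {f \<in> Arr C. Dom C f = X \<and> Cod C f = Y}"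

locale category =
  fixes C :: "('o, 'm, 'x) cat_scheme" (structure)
  assumes Dom_in_Obj: "f \<in> Arr C \<Longrightarrow> Dom C f \<in> Obj C"
    and Cod_in_Obj: "f \<in> Arr C \<Longrightarrow> Cod C f \<in> Obj C"
    and Ident_in_Hom: "X \<in> Obj C \<Longrightarrow> Ident C X \<in> Hom C X X"
    and Comp_in_Hom: "\<lbrakk>f \<in> Hom C X Y; g \<in> Hom C Y Z\<rbrakk> \<Longrightarrow> g \<cdot> f \<in> Hom C X Z"
    and Comp_Ident_left: "f \<in> Hom C X Y \<Longrightarrow> Ident C Y \<cdot> f = f"
    and Comp_Ident_right: "f \<in> Hom C X Y \<Longrightarrow> f \<cdot> Ident C X = f"
    and Comp_assoc: "\<lbrakk>f \<in> Hom C W X; g \<in> Hom C X Y; h \<in> Hom C Y Z\<rbrakk>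
      \<Longrightarrow> (h \<cdot> g) \<cdot> f = h \<cdot> (g \<cdot> f)"

definition zero_object :: "('o, 'm, 'x) cat_scheme \<Rightarrow> 'o \<Rightarrow> bool"
  where "zero_object C Z \<longleftrightarrow> Z \<in> Obj C \<and>
    (\<forall>X \<in> Obj C. (\<exists>!f. f \<in> Hom C X Z) \<and> (\<exists>!f. f \<in> Hom C Z X))"

text \<open>Meant for categories with exactly one zero object.\<close>

definition zero_obj :: "('o, 'm, 'x) cat_scheme \<Rightarrow> 'o"
  where "zero_obj C = (THE Z. zero_object C Z)"

record ('o, 'm) additive_cat = "('o, 'm) cat" +
  Add :: "'m \<Rightarrow> 'm \<Rightarrow> 'm"
  Zero :: "'o \<Rightarrow> 'o \<Rightarrow> 'm"

definition Hom_group :: "('o, 'm, 'x) additive_cat_scheme \<Rightarrow> 'o \<Rightarrow> 'o \<Rightarrow> 'm monoid"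
  where "Hom_group A X Y = \<lparr>carrier = Hom A X Y, monoid.mult = Add A, one = Zero A X Y\<rparr>"

definition Neg :: "('o, 'm, 'x) additive_cat_scheme \<Rightarrow> 'm \<Rightarrow> 'm"
  where "Neg A f = m_inv (Hom_group A (Dom A f) (Cod A f)) f"

locale additive_category = category A
  for A :: "('o, 'm, 'x) additive_cat_scheme" (structure) +
  assumes Hom_group: "\<lbrakk>X \<in> Obj A; Y \<in> Obj A\<rbrakk> \<Longrightarrow> comm_group (Hom_group A X Y)"
    and Comp_Add_left: "\<lbrakk>f \<in> Hom A X Y; g \<in> Hom A Y Z; g' \<in> Hom A Y Z\<rbrakk>
      \<Longrightarrow> Add A g g' \<cdot> f = Add A (g \<cdot> f) (g' \<cdot> f)"
    and Comp_Add_right: "\<lbrakk>f \<in> Hom A X Y; f' \<in> Hom A X Y; g \<in> Hom A Y Z\<rbrakk>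
      \<Longrightarrow> g \<cdot> Add A f f' = Add A (g \<cdot> f) (g \<cdot> f')"
    and zero_object_exists: "\<exists>Z. zero_object A Z"
    and biproduct_exists: "\<lbrakk>X \<in> Obj A; Y \<in> Obj A\<rbrakk> \<Longrightarrow>
      \<exists>P \<in> Obj A. \<exists>i \<in> Hom A X P. \<exists>j \<in> Hom A Y P. \<exists>p \<in> Hom A P X. \<exists>q \<in> Hom A P Y.
        p \<cdot> i = Ident A X \<and> q \<cdot> j = Ident A Y \<and>
        q \<cdot> i = Zero A X Y \<and> p \<cdot> j = Zero A Y X \<and>
        Add A (i \<cdot> p) (j \<cdot> q) = Ident A P"

record ('o, 'm) tensor_structure =
  Unit :: 'o
  TensO :: "'o \<Rightarrow> 'o \<Rightarrow> 'o" (infixr "\<odot>\<index>" 75)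
  TensA :: "'m \<Rightarrow> 'm \<Rightarrow> 'm" (infixr "\<odot>\<^sub>0\<index>" 75)

locale strict_monoidal_category = category C
  for C :: "('o, 'm, 'x) cat_scheme" (structure)
    and T :: "('o, 'm, 'y) tensor_structure_scheme" (structure) +
  assumes Unit_in_Obj: "Unit T \<in> Obj C"
    and TensO_in_Obj: "\<lbrakk>X \<in> Obj C; Y \<in> Obj C\<rbrakk> \<Longrightarrow> X \<odot>\<^bsub>T\<^esub> Y \<in> Obj C"
    and TensA_in_Hom: "\<lbrakk>f \<in> Hom C X X'; g \<in> Hom C Y Y'\<rbrakk>
      \<Longrightarrow> f \<odot>\<^sub>0\<^bsub>T\<^esub> g \<in> Hom C (X \<odot>\<^bsub>T\<^esub> Y) (X' \<odot>\<^bsub>T\<^esub> Y')"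
    and TensA_Ident: "\<lbrakk>X \<in> Obj C; Y \<in> Obj C\<rbrakk>
      \<Longrightarrow> Ident C X \<odot>\<^sub>0\<^bsub>T\<^esub> Ident C Y = Ident C (X \<odot>\<^bsub>T\<^esub> Y)"
    and TensA_Comp: "\<lbrakk>f \<in> Hom C X X'; f' \<in> Hom C X' X''; g \<in> Hom C Y Y'; g' \<in> Hom C Y' Y''\<rbrakk>
      \<Longrightarrow> (f' \<cdot> f) \<odot>\<^sub>0\<^bsub>T\<^esub> (g' \<cdot> g) = (f' \<odot>\<^sub>0\<^bsub>T\<^esub> g') \<cdot> (f \<odot>\<^sub>0\<^bsub>T\<^esub> g)"
    and TensO_assoc: "\<lbrakk>X \<in> Obj C; Y \<in> Obj C; Z \<in> Obj C\<rbrakk>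
      \<Longrightarrow> (X \<odot>\<^bsub>T\<^esub> Y) \<odot>\<^bsub>T\<^esub> Z = X \<odot>\<^bsub>T\<^esub> (Y \<odot>\<^bsub>T\<^esub> Z)"
    and TensA_assoc: "\<lbrakk>f \<in> Arr C; g \<in> Arr C; h \<in> Arr C\<rbrakk>
      \<Longrightarrow> (f \<odot>\<^sub>0\<^bsub>T\<^esub> g) \<odot>\<^sub>0\<^bsub>T\<^esub> h = f \<odot>\<^sub>0\<^bsub>T\<^esub> (g \<odot>\<^sub>0\<^bsub>T\<^esub> h)"
    and Unit_left: "X \<in> Obj C \<Longrightarrow> Unit T \<odot>\<^bsub>T\<^esub> X = X"
    and Unit_right: "X \<in> Obj C \<Longrightarrow> X \<odot>\<^bsub>T\<^esub> Unit T = X"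
    and Ident_Unit_left: "f \<in> Arr C \<Longrightarrow> Ident C (Unit T) \<odot>\<^sub>0\<^bsub>T\<^esub> f = f"
    and Ident_Unit_right: "f \<in> Arr C \<Longrightarrow> f \<odot>\<^sub>0\<^bsub>T\<^esub> Ident C (Unit T) = f"

definition biadditive_tensor ::
  "('o, 'm, 'x) additive_cat_scheme \<Rightarrow> ('o, 'm, 'y) tensor_structure_scheme \<Rightarrow> bool"
  where "biadditive_tensor A T \<longleftrightarrow>
    (\<forall>X X' Y Y'. \<forall>f \<in> Hom A X X'. \<forall>f' \<in> Hom A X X'. \<forall>g \<in> Hom A Y Y'. \<forall>g' \<in> Hom A Y Y'.
      Add A f f' \<odot>\<^sub>0\<^bsub>T\<^esub> g = Add A (f \<odot>\<^sub>0\<^bsub>T\<^esub> g) (f' \<odot>\<^sub>0\<^bsub>T\<^esub> g) \<and>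
      f \<odot>\<^sub>0\<^bsub>T\<^esub> Add A g g' = Add A (f \<odot>\<^sub>0\<^bsub>T\<^esub> g) (f \<odot>\<^sub>0\<^bsub>T\<^esub> g'))"

section \<open>Indices\<close>

text \<open>
  Positions are counted from 0: \<open>lookup a i\<close> is the usual \<open>a\<^sub>i\<^sub>+\<^sub>1\<close>. Hence a condition \<open>i \<le> n\<close>
  on positions in \<open>{1,2,\<dots>}\<close> becomes \<open>i < n\<close>, and \<open>i > n\<close> becomes \<open>i \<ge> n\<close>.
\<close>

type_synonym index = "nat \<Rightarrow>\<^sub>0 int"

abbreviation unit_index :: "nat \<Rightarrow> index" ("\<epsilon>")
  where "\<epsilon> i \<equiv> Poly_Mapping.single i 1"

definition ht :: "index \<Rightarrow> int"
  where "ht a = (\<Sum>i \<in> Poly_Mapping.keys a. Poly_Mapping.lookup a i)"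

definition level :: "int \<Rightarrow> index set"
  where "level k = {a. ht a = k}"

lift_definition trunc :: "nat \<Rightarrow> index \<Rightarrow> index" ("\<pi>")
  is "\<lambda>k a i. if i < k then a i else 0"
  by (simp add: conj_commute)

lift_definition shift :: "nat \<Rightarrow> index \<Rightarrow> index" ("\<sigma>")
  is "\<lambda>k a i. a (i + k)"
proof -
  fix k :: nat and a :: "nat \<Rightarrow> int"
  assume "finite {i. a i \<noteq> 0}"
  then have "finite ((\<lambda>i. i + k) -` {i. a i \<noteq> 0})"
    by (rule finite_vimageI) (simp add: inj_on_def)
  then show "finite {i. a (i + k) \<noteq> 0}"
    by (simp add: vimage_def)
qed

section \<open>Pyramids and their morphisms\<close>

record ('o, 'm) pyramid =
  ob :: "index \<Rightarrow> 'o"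
  df :: "index \<Rightarrow> nat \<Rightarrow> 'm"
  len :: nat

definition is_pyramid :: "('o, 'm, 'x) additive_cat_scheme \<Rightarrow> ('o, 'm) pyramid \<Rightarrow> bool"
  where "is_pyramid A P \<longleftrightarrow>
    (\<forall>a. ob P a \<in> Obj A) \<and>
    (\<forall>a i. df P a i \<in> Hom A (ob P a) (ob P (a + \<epsilon> i))) \<and>
    (\<forall>a. \<not> (\<forall>i \<ge> len P. Poly_Mapping.lookup a i = 0) \<longrightarrow> ob P a = zero_obj A) \<and>
    (\<exists>m :: int. \<forall>a. \<not> (\<forall>i. Poly_Mapping.lookup a i < m) \<longrightarrow> ob P a = zero_obj A) \<and>
    (\<forall>a i. df P (a + \<epsilon> i) i \<cdot>\<^bsub>A\<^esub> df P a i = Zero A (ob P a) (ob P (a + \<epsilon> i + \<epsilon> i))) \<and>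
    (\<forall>a i j. df P (a + \<epsilon> i) j \<cdot>\<^bsub>A\<^esub> df P a i = Neg A (df P (a + \<epsilon> j) i \<cdot>\<^bsub>A\<^esub> df P a j))"

text \<open>
  Matrix families are extensional in the sense of \<^const>\<open>PiE\<close>: the \<open>k\<close>-th matrix is
  \<^const>\<open>undefined\<close> outside its rows and columns, so that equality of families is equality of
  all their entries.
\<close>

type_synonym 'm matrix = "index \<Rightarrow> index \<Rightarrow> 'm"

record ('o, 'm) pyramid_mor =
  src :: "('o, 'm) pyramid"
  tgt :: "('o, 'm) pyramid"
  mat :: "int \<Rightarrow> 'm matrix"

text \<open>
  Sum of the nonzero members of a family in the abelian group of arrows \<open>X \<rightarrow> Y\<close>;
  \<^const>\<open>finprod\<close> is the iterated operation of that (multiplicatively written) group.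
\<close>

definition hom_sum ::
  "('o, 'm, 'x) additive_cat_scheme \<Rightarrow> 'o \<Rightarrow> 'o \<Rightarrow> ('i \<Rightarrow> 'm) \<Rightarrow> 'i set \<Rightarrow> 'm"
  where "hom_sum A X Y f S = finprod (Hom_group A X Y) f {c \<in> S. f c \<noteq> Zero A X Y}"

text \<open>
  Product of a matrix \<open>M\<close> with rows \<open>level p\<close>, columns \<open>level q\<close> and a matrix \<open>N\<close> with rows
  \<open>level q\<close>, columns \<open>level r\<close>. The columns of \<open>N\<close> start at the objects \<open>X b\<close>, the rows of \<open>M\<close>
  end at the objects \<open>Y a\<close>.
\<close>

definition mat_mult :: "('o, 'm, 'x) additive_cat_scheme \<Rightarrow> (index \<Rightarrow> 'o) \<Rightarrow> (index \<Rightarrow> 'o)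
    \<Rightarrow> int \<Rightarrow> int \<Rightarrow> int \<Rightarrow> 'm matrix \<Rightarrow> 'm matrix \<Rightarrow> 'm matrix"
  where "mat_mult A X Y p q r M N =
    (\<lambda>a \<in> level p. \<lambda>b \<in> level r. hom_sum A (X b) (Y a) (\<lambda>c. M a c \<cdot>\<^bsub>A\<^esub> N c b) (level q))"

definition df_mat :: "('o, 'm, 'x) additive_cat_scheme \<Rightarrow> ('o, 'm) pyramid \<Rightarrow> int \<Rightarrow> 'm matrix"
  where "df_mat A P k = (\<lambda>a \<in> level (k + 1). \<lambda>b \<in> level k.
    if \<exists>i. a = b + \<epsilon> i then df P b (THE i. a = b + \<epsilon> i) else Zero A (ob P b) (ob P a))"

definition is_pyramid_mor ::
  "('o, 'm, 'x) additive_cat_scheme \<Rightarrow> ('o, 'm) pyramid_mor \<Rightarrow> bool"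
  where "is_pyramid_mor A \<alpha> \<longleftrightarrow> is_pyramid A (src \<alpha>) \<and> is_pyramid A (tgt \<alpha>) \<and>
    (\<forall>k. mat \<alpha> k \<in> (\<Pi>\<^sub>E a \<in> level k. \<Pi>\<^sub>E b \<in> level k. Hom A (ob (src \<alpha>) b) (ob (tgt \<alpha>) a))) \<and>
    (\<forall>k. mat_mult A (ob (src \<alpha>)) (ob (tgt \<alpha>)) (k + 1) (k + 1) k (mat \<alpha> (k + 1)) (df_mat A (src \<alpha>) k)
       = mat_mult A (ob (src \<alpha>)) (ob (tgt \<alpha>)) (k + 1) k k (df_mat A (tgt \<alpha>) k) (mat \<alpha> k))"

definition pyramid_ident ::
  "('o, 'm, 'x) additive_cat_scheme \<Rightarrow> ('o, 'm) pyramid \<Rightarrow> ('o, 'm) pyramid_mor"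
  where "pyramid_ident A P = \<lparr>src = P, tgt = P,
    mat = (\<lambda>k. \<lambda>a \<in> level k. \<lambda>b \<in> level k.
      if a = b then Ident A (ob P a) else Zero A (ob P b) (ob P a))\<rparr>"

definition pyramid_comp :: "('o, 'm, 'x) additive_cat_scheme
    \<Rightarrow> ('o, 'm) pyramid_mor \<Rightarrow> ('o, 'm) pyramid_mor \<Rightarrow> ('o, 'm) pyramid_mor"
  where "pyramid_comp A \<beta> \<alpha> = \<lparr>src = src \<alpha>, tgt = tgt \<beta>,
    mat = (\<lambda>k. mat_mult A (ob (src \<alpha>)) (ob (tgt \<beta>)) k k k (mat \<beta> k) (mat \<alpha> k))\<rparr>"

definition pyramid_category ::
  "('o, 'm, 'x) additive_cat_scheme \<Rightarrow> (('o, 'm) pyramid, ('o, 'm) pyramid_mor) cat"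
  where "pyramid_category A = \<lparr>
    Obj = {P. is_pyramid A P},
    Arr = {\<alpha>. is_pyramid_mor A \<alpha>},
    Dom = src, Cod = tgt,
    Ident = pyramid_ident A,
    Comp = pyramid_comp A\<rparr>"

text \<open>
  The sums occurring in \<^const>\<open>mat_mult\<close> are finite, since only finitely many objects in each
  level of a pyramid are nonzero.
\<close>

lemma finite_level_support:
  assumes "is_pyramid A P"
  shows "finite {a \<in> level k. ob P a \<noteq> zero_obj A}"
proof -
  obtain m :: int where m: "\<And>a. \<not> (\<forall>i. Poly_Mapping.lookup a i < m) \<Longrightarrow> ob P a = zero_obj A"
    using assms unfolding is_pyramid_def by blast
  have l: "\<And>a. \<not> (\<forall>i \<ge> len P. Poly_Mapping.lookup a i = 0) \<Longrightarrow> ob P a = zero_obj A"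
    using assms unfolding is_pyramid_def by blast
  let ?n = "len P" and ?S = "{a \<in> level k. ob P a \<noteq> zero_obj A}"
  let ?F = "{f. \<forall>i. (i \<in> {..<?n} \<longrightarrow> f i \<in> {k - int ?n * \<bar>m\<bar> .. m}) \<and> (i \<notin> {..<?n} \<longrightarrow> f i = 0)}"
  have "Poly_Mapping.lookup ` ?S \<subseteq> ?F"
  proof clarify
    fix a i assume a: "a \<in> level k" and nz: "ob P a \<noteq> zero_obj A"
    have up: "Poly_Mapping.lookup a j < m" for j using m nz by blast
    have z: "Poly_Mapping.lookup a j = 0" if "j \<ge> ?n" for j using l nz that by blast
    have "k = (\<Sum>j \<in> Poly_Mapping.keys a. Poly_Mapping.lookup a j)" using a by (simp add: level_def ht_def)
    also have "\<dots> = (\<Sum>j<?n. Poly_Mapping.lookup a j)"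
    proof (rule sum.mono_neutral_left)
      show "Poly_Mapping.keys a \<subseteq> {..<?n}"
      proof
        fix j assume "j \<in> Poly_Mapping.keys a"
        then have "Poly_Mapping.lookup a j \<noteq> 0" by (simp add: in_keys_iff)
        then have "\<not> ?n \<le> j" using z by blast
        then show "j \<in> {..<?n}" by simp
      qed
    qed (simp_all add: in_keys_iff)
    finally have k: "k = (\<Sum>j<?n. Poly_Mapping.lookup a j)" .
    have "k - int ?n * \<bar>m\<bar> \<le> Poly_Mapping.lookup a i" if "i < ?n"
    proof -
      have "(\<Sum>j \<in> {..<?n} - {i}. Poly_Mapping.lookup a j) \<le> of_nat (card ({..<?n} - {i})) * \<bar>m\<bar>"
        by (rule sum_bounded_above, rule order.trans[OF less_imp_le[OF up] abs_ge_self])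
      also have "\<dots> \<le> int ?n * \<bar>m\<bar>" using that by (intro mult_right_mono) auto
      moreover have "k = Poly_Mapping.lookup a i + (\<Sum>j \<in> {..<?n} - {i}. Poly_Mapping.lookup a j)"
        unfolding k using that by (intro sum.remove) simp_all
      ultimately show ?thesis by linarith
    qed
    then show "(i \<in> {..<?n} \<longrightarrow> Poly_Mapping.lookup a i \<in> {k - int ?n * \<bar>m\<bar> .. m})
      \<and> (i \<notin> {..<?n} \<longrightarrow> Poly_Mapping.lookup a i = 0)"
      using up[of i] z[of i] by auto
  qed
  moreover have "finite ?F" by (rule finite_set_of_finite_funs) auto
  ultimately have "finite (Poly_Mapping.lookup ` ?S)" by (rule finite_subset)
  then show ?thesis by (rule finite_imageD) (rule inj_onI, rule poly_mapping_eqI, simp)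
qed

section \<open>Tensor product of pyramids\<close>

definition pyramid_tensO :: "('o, 'm, 'x) additive_cat_scheme \<Rightarrow> ('o, 'm, 'y) tensor_structure_scheme
    \<Rightarrow> ('o, 'm) pyramid \<Rightarrow> ('o, 'm) pyramid \<Rightarrow> ('o, 'm) pyramid"
  where "pyramid_tensO A T P Q = (let n = len P in \<lparr>
    ob = (\<lambda>a. ob P (\<pi> n a) \<odot>\<^bsub>T\<^esub> ob Q (\<sigma> n a)),
    df = (\<lambda>a i.
      if i < n then df P (\<pi> n a) i \<odot>\<^sub>0\<^bsub>T\<^esub> Ident A (ob Q (\<sigma> n a))
      else if even (ht (\<pi> n a)) then Ident A (ob P (\<pi> n a)) \<odot>\<^sub>0\<^bsub>T\<^esub> df Q (\<sigma> n a) (i - n)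
      else Neg A (Ident A (ob P (\<pi> n a)) \<odot>\<^sub>0\<^bsub>T\<^esub> df Q (\<sigma> n a) (i - n))),
    len = n + len Q\<rparr>)"

definition pyramid_tensA :: "('o, 'm, 'x) additive_cat_scheme \<Rightarrow> ('o, 'm, 'y) tensor_structure_scheme
    \<Rightarrow> ('o, 'm) pyramid_mor \<Rightarrow> ('o, 'm) pyramid_mor \<Rightarrow> ('o, 'm) pyramid_mor"
  where "pyramid_tensA A T \<alpha> \<beta> =
    (let P = pyramid_tensO A T (src \<alpha>) (src \<beta>); P' = pyramid_tensO A T (tgt \<alpha>) (tgt \<beta>);
         n = len (src \<alpha>); n' = len (tgt \<alpha>)
     in \<lparr>src = P, tgt = P',
         mat = (\<lambda>k. \<lambda>a \<in> level k. \<lambda>b \<in> level k.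
           let l = ht (\<pi> n' a) in
           if l = ht (\<pi> n b)
           then mat \<alpha> l (\<pi> n' a) (\<pi> n b) \<odot>\<^sub>0\<^bsub>T\<^esub> mat \<beta> (k - l) (\<sigma> n' a) (\<sigma> n b)
           else Zero A (ob P b) (ob P' a))\<rparr>)"

text \<open>The identity object of \<open>A\<close> at index 0, with length 0.\<close>

definition pyramid_unit ::
  "('o, 'm, 'x) additive_cat_scheme \<Rightarrow> ('o, 'm, 'y) tensor_structure_scheme \<Rightarrow> ('o, 'm) pyramid"
  where "pyramid_unit A T =
    (let X = (\<lambda>a. if a = 0 then Unit T else zero_obj A)
     in \<lparr>ob = X, df = (\<lambda>a i. Zero A (X a) (X (a + \<epsilon> i))), len = 0\<rparr>)"

definition pyramid_tensor ::
  "('o, 'm, 'x) additive_cat_scheme \<Rightarrow> ('o, 'm, 'y) tensor_structure_scheme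
    \<Rightarrow> (('o, 'm) pyramid, ('o, 'm) pyramid_mor) tensor_structure"
  where "pyramid_tensor A T = \<lparr>
    Unit = pyramid_unit A T,
    TensO = pyramid_tensO A T,
    TensA = pyramid_tensA A T\<rparr>"

end

theory Submission
  imports Defs
begin

text \<open>
  The category \<open>A\<close> has a single zero object \<open>0\<close>; by biadditivity \<open>0 \<odot> X = X \<odot> 0 = 0\<close>, because the
  identity of either product is a zero arrow. A pyramid has only finitely many nonzero objects in
  each level, so its matrices compose like ordinary matrices: multiplication is associative
  (\<open>mat_mult_assoc\<close>) and has the identity matrices as units. This makes pyramids a category, and
  shows that composites of morphisms commute with the differentials.

  For the tensor product, an index \<open>a\<close> is split at position \<open>n\<close> into \<open>(\<pi> n a, \<sigma> n a)\<close>, with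
  \<open>ht a = ht (\<pi> n a) + ht (\<sigma> n a)\<close>. On objects, everything follows by comparing the two ways of
  splitting. The sign \<open>(-1)\<^bsup>ht (\<pi> n a)\<^esup>\<close> makes the two families of differentials anticommute
  (\<open>tensO_pyramid\<close>), and additivity of the height makes the signs agree in triple products
  (\<open>tensO_assoc\<close>).

  On morphisms, the differential of a pyramid \<open>P\<close> with \<open>len P = n\<close> has at most \<open>n\<close> nonzero entries
  \<open>df P b i\<close>, \<open>i < n\<close>, in column \<open>b\<close>, and at most \<open>n\<close> in each row. Hence a family of
  matrices \<open>\<alpha>\<close> from \<open>P\<close> to \<open>Q\<close> is a morphism iff for all \<open>a, b\<close> with \<open>ht a = ht b + 1\<close>
  the sum of \<open>\<alpha> a (b + \<epsilon> i) \<cdot> df P b i\<close> over \<open>i < len P\<close> is the sum of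
  \<open>df Q (a - \<epsilon> i) i \<cdot> \<alpha> (a - \<epsilon> i) b\<close> over \<open>i < len Q\<close> (\<open>is_pyramid_mor_entry\<close>). For a tensor product
  \<open>\<alpha> \<odot>\<^sub>0 \<beta>\<close> each side splits into the directions belonging to \<open>\<alpha>\<close> and those belonging to \<open>\<beta>\<close>.
  Since \<open>\<alpha> \<odot>\<^sub>0 \<beta>\<close> vanishes between indices whose first parts have different heights, the former
  contribute only if the heights of the first parts of \<open>a\<close> and \<open>b\<close> differ by one, and there the identity
  is the one for \<open>\<alpha>\<close> tensored with an entry of \<open>\<beta>\<close>; the latter contribute only if these heights
  are equal, so that both sides carry the same sign, and there it is the identity for \<open>\<beta>\<close>
  (\<open>tensA_mor\<close>). Functoriality (\<open>tensA_comp\<close>) is the expansion of a tensor product of two sums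
  into a double sum, the pairs of summation indices being joined into one index.
\<close>

section \<open>Sums and signs in an additive category\<close>

lemma Hom_group_simps [simp]:
  "carrier (Hom_group A X Y) = Hom A X Y"
  "monoid.mult (Hom_group A X Y) = Add A"
  "one (Hom_group A X Y) = Zero A X Y"
  by (simp_all add: Hom_group_def)

context additive_category
begin

lemma Hom_Obj:
  assumes "f \<in> Hom A X Y"
  shows "X \<in> Obj A" and "Y \<in> Obj A"
  using assms Dom_in_Obj Cod_in_Obj by (auto simp: Hom_def)

lemma Hom_comm_monoid: "X \<in> Obj A \<Longrightarrow> Y \<in> Obj A \<Longrightarrow> comm_monoid (Hom_group A X Y)"
  using Hom_group comm_group.axioms(1) by blast

lemma Hom_is_group: "X \<in> Obj A \<Longrightarrow> Y \<in> Obj A \<Longrightarrow> group (Hom_group A X Y)"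
  using Hom_group comm_group.axioms(2) by blast

lemma Zero_in_Hom: "X \<in> Obj A \<Longrightarrow> Y \<in> Obj A \<Longrightarrow> Zero A X Y \<in> Hom A X Y"
  using monoid.one_closed[OF group.is_monoid[OF Hom_is_group]] by simp

lemma Add_in_Hom: "f \<in> Hom A X Y \<Longrightarrow> g \<in> Hom A X Y \<Longrightarrow> Add A f g \<in> Hom A X Y"
  using monoid.m_closed[OF group.is_monoid[OF Hom_is_group], of X Y f g] Hom_Obj[of f X Y] by simp

lemma Neg_in_Hom: "f \<in> Hom A X Y \<Longrightarrow> Neg A f \<in> Hom A X Y"
  using group.inv_closed[OF Hom_is_group, of X Y f] Hom_Obj[of f X Y] by (auto simp: Neg_def Hom_def)

lemma Neg_Hom: "f \<in> Hom A X Y \<Longrightarrow> Neg A f = m_inv (Hom_group A X Y) f"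
  by (auto simp: Neg_def Hom_def)

lemma Neg_Neg: "f \<in> Hom A X Y \<Longrightarrow> Neg A (Neg A f) = f"
  using group.inv_inv[OF Hom_is_group, of X Y f] Hom_Obj[of f X Y] Neg_in_Hom[of f X Y]
  by (simp add: Neg_Hom)

lemma Neg_Zero: "X \<in> Obj A \<Longrightarrow> Y \<in> Obj A \<Longrightarrow> Neg A (Zero A X Y) = Zero A X Y"
  using monoid.inv_one[OF group.is_monoid[OF Hom_is_group], of X Y] Zero_in_Hom[of X Y] by (simp add: Neg_Hom)

lemma Neg_additive:
  assumes "X \<in> Obj A" "Y \<in> Obj A"
  shows "Neg A \<in> hom (Hom_group A X Y) (Hom_group A X Y)"
proof -
  interpret comm_group "Hom_group A X Y" using Hom_group assms by blast
  show ?thesis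
    using inv_mult inv_closed by (intro homI) (auto simp: Neg_in_Hom Neg_Hom[where X = X and Y = Y] Add_in_Hom)
qed

lemma Comp_additive_right:
  assumes "g \<in> Hom A Y Z" and "X \<in> Obj A"
  shows "(\<lambda>f. g \<cdot> f) \<in> hom (Hom_group A X Y) (Hom_group A X Z)"
  using assms Comp_in_Hom Comp_Add_right by (auto simp: hom_def)

lemma Comp_additive_left:
  assumes "f \<in> Hom A X Y" and "Z \<in> Obj A"
  shows "(\<lambda>g. g \<cdot> f) \<in> hom (Hom_group A Y Z) (Hom_group A X Z)"
  using assms Comp_in_Hom Comp_Add_left by (auto simp: hom_def)

text \<open>An additive map between arrow groups preserves zero, negatives and sums. This is applied to
  composition with, and tensoring by, a fixed arrow.\<close>

context
  fixes X Y X' Y' \<phi>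
  assumes obj: "X \<in> Obj A" "Y \<in> Obj A" "X' \<in> Obj A" "Y' \<in> Obj A"
    and \<phi>: "\<phi> \<in> hom (Hom_group A X Y) (Hom_group A X' Y')"
begin

interpretation group_hom "Hom_group A X Y" "Hom_group A X' Y'" \<phi>
  using obj \<phi> Hom_is_group by (simp add: group_hom_def group_hom_axioms_def)

lemma additive_Zero: "\<phi> (Zero A X Y) = Zero A X' Y'"
  using hom_one by simp

lemma additive_Neg: "f \<in> Hom A X Y \<Longrightarrow> \<phi> (Neg A f) = Neg A (\<phi> f)"
  using hom_inv[of f] hom_closed[of f] by (simp add: Neg_Hom)

lemma additive_sum:
  assumes "f \<in> S \<rightarrow> Hom A X Y"
  shows "\<phi> (finprod (Hom_group A X Y) f S) = finprod (Hom_group A X' Y') (\<lambda>s. \<phi> (f s)) S"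
proof -
  interpret S: comm_monoid "Hom_group A X Y" using Hom_comm_monoid obj by simp
  interpret S': comm_monoid "Hom_group A X' Y'" using Hom_comm_monoid obj by simp
  show ?thesis
    using assms
  proof (induction S rule: infinite_finite_induct)
    case (insert x F)
    then have f: "f \<in> F \<rightarrow> carrier (Hom_group A X Y)" "f x \<in> carrier (Hom_group A X Y)" by auto
    then have f': "(\<lambda>s. \<phi> (f s)) \<in> F \<rightarrow> carrier (Hom_group A X' Y')"
      "\<phi> (f x) \<in> carrier (Hom_group A X' Y')"
      using hom_closed by (auto simp: Pi_iff simp del: Hom_group_simps)
    show ?case
      using insert S.finprod_insert[OF insert(1,2) f] S'.finprod_insert[OF insert(1,2) f']
        hom_mult[OF f(2) S.finprod_closed[OF f(1)]] by auto
  qed (use hom_one in simp_all)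
qed

end

lemma Comp_Zero_right: "g \<in> Hom A Y Z \<Longrightarrow> X \<in> Obj A \<Longrightarrow> g \<cdot> Zero A X Y = Zero A X Z"
  using additive_Zero[OF _ _ _ _ Comp_additive_right, of X Y Z g] Hom_Obj[of g Y Z] by simp

lemma Comp_Zero_left: "f \<in> Hom A X Y \<Longrightarrow> Z \<in> Obj A \<Longrightarrow> Zero A Y Z \<cdot> f = Zero A X Z"
  using additive_Zero[OF _ _ _ _ Comp_additive_left, of Y Z X f] Hom_Obj[of f X Y] by simp

lemma Comp_Neg_right: "g \<in> Hom A Y Z \<Longrightarrow> f \<in> Hom A X Y \<Longrightarrow> g \<cdot> Neg A f = Neg A (g \<cdot> f)"
  using additive_Neg[OF _ _ _ _ Comp_additive_right, of X Y Z g f] Hom_Obj[of g Y Z]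
    Hom_Obj[of f X Y] by simp

lemma Comp_Neg_left: "g \<in> Hom A Y Z \<Longrightarrow> f \<in> Hom A X Y \<Longrightarrow> Neg A g \<cdot> f = Neg A (g \<cdot> f)"
  using additive_Neg[OF _ _ _ _ Comp_additive_left, of Y Z X f g] Hom_Obj[of g Y Z]
    Hom_Obj[of f X Y] by simp

lemma Comp_sum_right:
  assumes "g \<in> Hom A Y Z" "X \<in> Obj A" "f \<in> S \<rightarrow> Hom A X Y"
  shows "g \<cdot> finprod (Hom_group A X Y) f S = finprod (Hom_group A X Z) (\<lambda>s. g \<cdot> f s) S"
  using additive_sum[OF _ _ _ _ Comp_additive_right assms(3), of Z g] assms Hom_Obj[of g Y Z] by simp

lemma Comp_sum_left:
  assumes "f \<in> Hom A X Y" "Z \<in> Obj A" "g \<in> S \<rightarrow> Hom A Y Z"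
  shows "finprod (Hom_group A Y Z) g S \<cdot> f = finprod (Hom_group A X Z) (\<lambda>s. g s \<cdot> f) S"
  using additive_sum[OF _ _ _ _ Comp_additive_left assms(3), of X f] assms Hom_Obj[of f X Y] by simp

lemma sum_in_Hom:
  assumes "X \<in> Obj A" "Y \<in> Obj A" "f \<in> S \<rightarrow> Hom A X Y"
  shows "finprod (Hom_group A X Y) f S \<in> Hom A X Y"
  using comm_monoid.finprod_closed[OF Hom_comm_monoid, of X Y f S] assms by simp

lemma sum_cong:
  assumes "X \<in> Obj A" "Y \<in> Obj A" "g \<in> S \<rightarrow> Hom A X Y" "\<And>s. s \<in> S \<Longrightarrow> f s = g s"
  shows "finprod (Hom_group A X Y) f S = finprod (Hom_group A X Y) g S"
  using comm_monoid.finprod_cong'[OF Hom_comm_monoid, of X Y S S g f] assms by simp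

lemma sum_empty:
  assumes "X \<in> Obj A" "Y \<in> Obj A"
  shows "finprod (Hom_group A X Y) f {} = Zero A X Y"
  using comm_monoid.finprod_empty[OF Hom_comm_monoid, of X Y f] assms by simp

lemma sum_Zero:
  assumes "X \<in> Obj A" "Y \<in> Obj A" "\<And>s. s \<in> S \<Longrightarrow> f s = Zero A X Y"
  shows "finprod (Hom_group A X Y) f S = Zero A X Y"
  using comm_monoid.finprod_one_eqI[OF Hom_comm_monoid, of X Y S f] assms by simp

lemma sum_reindex:
  assumes "X \<in> Obj A" "Y \<in> Obj A" "inj_on h S" "\<And>s. s \<in> S \<Longrightarrow> f (h s) \<in> Hom A X Y"
  shows "finprod (Hom_group A X Y) f (h ` S) = finprod (Hom_group A X Y) (\<lambda>s. f (h s)) S"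
  using comm_monoid.finprod_reindex[OF Hom_comm_monoid, of X Y f h S] assms by auto

lemma sum_Un_disjoint:
  assumes "X \<in> Obj A" "Y \<in> Obj A" "finite S" "finite S'" "S \<inter> S' = {}" "f \<in> S \<union> S' \<rightarrow> Hom A X Y"
  shows "finprod (Hom_group A X Y) f (S \<union> S')
    = Add A (finprod (Hom_group A X Y) f S) (finprod (Hom_group A X Y) f S')"
  using comm_monoid.finprod_Un_disjoint[OF Hom_comm_monoid, of X Y S S' f] assms by (auto simp: Pi_iff)

lemma Add_Zero:
  assumes "f \<in> Hom A X Y"
  shows "Add A f (Zero A X Y) = f" and "Add A (Zero A X Y) f = f"
  using monoid.r_one[OF group.is_monoid[OF Hom_is_group], of X Y f]
    monoid.l_one[OF group.is_monoid[OF Hom_is_group], of X Y f] Hom_Obj[OF assms] assms by simp_all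

lemma sum_insert:
  assumes "X \<in> Obj A" "Y \<in> Obj A" "finite S" "s \<notin> S" "f \<in> insert s S \<rightarrow> Hom A X Y"
  shows "finprod (Hom_group A X Y) f (insert s S) = Add A (f s) (finprod (Hom_group A X Y) f S)"
  using comm_monoid.finprod_insert[OF Hom_comm_monoid, of X Y S s f] assms by auto

lemma sum_Add:
  assumes "X \<in> Obj A" "Y \<in> Obj A" "f \<in> S \<rightarrow> Hom A X Y" "g \<in> S \<rightarrow> Hom A X Y"
  shows "finprod (Hom_group A X Y) (\<lambda>s. Add A (f s) (g s)) S
    = Add A (finprod (Hom_group A X Y) f S) (finprod (Hom_group A X Y) g S)"
  using comm_monoid.finprod_multf[OF Hom_comm_monoid, of X Y f S g] assms by simp

lemma sum_Times:
  assumes "X \<in> Obj A" "Y \<in> Obj A" "finite S" "finite R"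
    and f: "\<And>s r. s \<in> S \<Longrightarrow> r \<in> R \<Longrightarrow> f s r \<in> Hom A X Y"
  shows "finprod (Hom_group A X Y) (\<lambda>(s, r). f s r) (S \<times> R)
    = finprod (Hom_group A X Y) (\<lambda>s. finprod (Hom_group A X Y) (f s) R) S"
  using \<open>finite S\<close> f
proof (induction S rule: finite_induct)
  case empty
  show ?case by (simp add: sum_empty sum_Zero assms)
next
  case (insert s S)
  have split: "insert s S \<times> R = Pair s ` R \<union> S \<times> R" by auto
  have "finprod (Hom_group A X Y) (\<lambda>(s, r). f s r) (Pair s ` R) = finprod (Hom_group A X Y) (f s) R"
    by (subst sum_reindex) (use insert assms in \<open>auto intro: inj_onI\<close>)
  moreover have "finprod (Hom_group A X Y) (\<lambda>(s, r). f s r) (insert s S \<times> R)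
    = Add A (finprod (Hom_group A X Y) (\<lambda>(s, r). f s r) (Pair s ` R))
       (finprod (Hom_group A X Y) (\<lambda>(s, r). f s r) (S \<times> R))"
    unfolding split by (rule sum_Un_disjoint) (use insert assms in auto)
  moreover have "finprod (Hom_group A X Y) (\<lambda>s. finprod (Hom_group A X Y) (f s) R) (insert s S)
    = Add A (finprod (Hom_group A X Y) (f s) R)
       (finprod (Hom_group A X Y) (\<lambda>s. finprod (Hom_group A X Y) (f s) R) S)"
    by (rule sum_insert) (use insert assms in \<open>auto intro!: sum_in_Hom\<close>)
  ultimately show ?case using insert by simp
qed

lemma sum_swap:
  assumes "X \<in> Obj A" "Y \<in> Obj A" "finite S" "finite R"
    and f: "\<And>s r. s \<in> S \<Longrightarrow> r \<in> R \<Longrightarrow> f s r \<in> Hom A X Y"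
  shows "finprod (Hom_group A X Y) (\<lambda>s. finprod (Hom_group A X Y) (\<lambda>r. f s r) R) S
    = finprod (Hom_group A X Y) (\<lambda>r. finprod (Hom_group A X Y) (\<lambda>s. f s r) S) R"
  using \<open>finite S\<close> f
proof (induction S rule: finite_induct)
  case empty
  show ?case by (simp add: sum_empty sum_Zero assms)
next
  case (insert s S)
  have "finprod (Hom_group A X Y) (\<lambda>r. finprod (Hom_group A X Y) (\<lambda>s. f s r) (insert s S)) R
    = finprod (Hom_group A X Y)
        (\<lambda>r. Add A (f s r) (finprod (Hom_group A X Y) (\<lambda>s. f s r) S)) R"
    by (rule sum_cong)
      (use insert assms in \<open>auto intro!: sum_insert sum_in_Hom Add_in_Hom\<close>)
  also have "\<dots> = Add A (finprod (Hom_group A X Y) (f s) R)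
    (finprod (Hom_group A X Y) (\<lambda>r. finprod (Hom_group A X Y) (\<lambda>s. f s r) S) R)"
    by (rule sum_Add) (use insert assms in \<open>auto intro!: sum_in_Hom\<close>)
  also have "\<dots> = Add A (finprod (Hom_group A X Y) (f s) R)
    (finprod (Hom_group A X Y) (\<lambda>s. finprod (Hom_group A X Y) (\<lambda>r. f s r) R) S)"
    using insert by simp
  also have "\<dots> = finprod (Hom_group A X Y)
    (\<lambda>s. finprod (Hom_group A X Y) (\<lambda>r. f s r) R) (insert s S)"
    by (rule sum_insert[symmetric]) (use insert assms in \<open>auto intro!: sum_in_Hom\<close>)
  finally show ?case by simp
qed

lemma sum_singleton:
  assumes "f s \<in> Hom A X Y"
  shows "finprod (Hom_group A X Y) f {s} = f s"
  using sum_insert[of X Y "{}" s f] assms Hom_Obj[OF assms] by (simp add: sum_empty Add_Zero)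

lemma sum_split:
  fixes n m :: nat
  assumes "X \<in> Obj A" "Y \<in> Obj A" "\<And>i. i < n + m \<Longrightarrow> f i \<in> Hom A X Y"
  shows "finprod (Hom_group A X Y) f {..<n + m}
    = Add A (finprod (Hom_group A X Y) f {..<n}) (finprod (Hom_group A X Y) (\<lambda>j. f (n + j)) {..<m})"
proof -
  have "i \<in> (\<lambda>j. n + j) ` {..<m}" if "i < n + m" "\<not> i < n" for i :: nat
    by (rule image_eqI[of _ _ "i - n"]) (use that in auto)
  then have "{..<n + m} = {..<n} \<union> (\<lambda>j. n + j) ` {..<m}"
    by auto
  then have "finprod (Hom_group A X Y) f {..<n + m}
    = Add A (finprod (Hom_group A X Y) f {..<n}) (finprod (Hom_group A X Y) f ((\<lambda>j. n + j) ` {..<m}))"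
    using assms by (simp only:, intro sum_Un_disjoint) auto
  then show ?thesis using assms by (subst (asm) sum_reindex) auto
qed

text \<open>\<^const>\<open>hom_sum\<close> may be computed on any finite set that contains the support.\<close>

lemma hom_sum_eq_sum:
  assumes "X \<in> Obj A" "Y \<in> Obj A" "finite F" "F \<subseteq> S" "\<And>s. s \<in> F \<Longrightarrow> f s \<in> Hom A X Y"
    and "\<And>s. s \<in> S - F \<Longrightarrow> f s = Zero A X Y"
  shows "hom_sum A X Y f S = finprod (Hom_group A X Y) f F"
  unfolding hom_sum_def
  by (rule comm_monoid.finprod_mono_neutral_cong_left[OF Hom_comm_monoid]) (use assms in auto)

end

text \<open>\<open>signed A s f\<close> is \<open>(-1)\<^sup>s f\<close>.\<close>

definition signed :: "('o, 'm, 'x) additive_cat_scheme \<Rightarrow> int \<Rightarrow> 'm \<Rightarrow> 'm"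
  where "signed A s f = (if even s then f else Neg A f)"

context additive_category
begin

lemma signed_in_Hom: "f \<in> Hom A X Y \<Longrightarrow> signed A s f \<in> Hom A X Y"
  by (simp add: signed_def Neg_in_Hom)

lemma signed_signed: "f \<in> Hom A X Y \<Longrightarrow> signed A s (signed A t f) = signed A (s + t) f"
  by (auto simp: signed_def Neg_Neg)

lemma Neg_signed: "f \<in> Hom A X Y \<Longrightarrow> Neg A (signed A s f) = signed A (s + 1) f"
  by (auto simp: signed_def Neg_Neg)

lemma Comp_signed_left: "g \<in> Hom A Y Z \<Longrightarrow> f \<in> Hom A X Y \<Longrightarrow> signed A s g \<cdot> f = signed A s (g \<cdot> f)"
  by (simp add: signed_def Comp_Neg_left)

lemma Comp_signed_right: "g \<in> Hom A Y Z \<Longrightarrow> f \<in> Hom A X Y \<Longrightarrow> g \<cdot> signed A s f = signed A s (g \<cdot> f)"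
  by (simp add: signed_def Comp_Neg_right)

lemma signed_sum:
  assumes "X \<in> Obj A" "Y \<in> Obj A" "f \<in> S \<rightarrow> Hom A X Y"
  shows "finprod (Hom_group A X Y) (\<lambda>i. signed A s (f i)) S = signed A s (finprod (Hom_group A X Y) f S)"
  using additive_sum[OF assms(1,2,1,2) Neg_additive assms(3)] assms by (simp add: signed_def)

end

section \<open>Zero objects\<close>

text \<open>Additive categories whose zero objects are identified.\<close>

locale additive_category_unique_zero = additive_category A
  for A :: "('o, 'm, 'x) additive_cat_scheme" (structure) +
  assumes unique_zero: "\<And>Z Z'. zero_object A Z \<Longrightarrow> zero_object A Z' \<Longrightarrow> Z = Z'"
begin

lemma zero_object_zero_obj: "zero_object A (zero_obj A)"
  unfolding zero_obj_def using zero_object_exists unique_zero by (metis theI)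

lemma zero_obj_eqI: "zero_object A Z \<Longrightarrow> Z = zero_obj A"
  using unique_zero zero_object_zero_obj by blast

lemma zero_obj_in_Obj: "zero_obj A \<in> Obj A"
  using zero_object_zero_obj by (simp add: zero_object_def)

lemma Hom_to_zero_obj: "f \<in> Hom A X (zero_obj A) \<Longrightarrow> f = Zero A X (zero_obj A)"
  using zero_object_zero_obj Zero_in_Hom Hom_Obj unfolding zero_object_def by metis

lemma Hom_from_zero_obj: "f \<in> Hom A (zero_obj A) X \<Longrightarrow> f = Zero A (zero_obj A) X"
  using zero_object_zero_obj Zero_in_Hom Hom_Obj unfolding zero_object_def by metis

lemma Hom_zero_obj_unique:
  assumes "f \<in> Hom A X Y" "g \<in> Hom A X Y" "X = zero_obj A \<or> Y = zero_obj A"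
  shows "f = g"
  using assms Hom_to_zero_obj Hom_from_zero_obj by metis

text \<open>An object whose identity vanishes is a zero object, since every arrow to or from it factors
  through that identity.\<close>

lemma zero_objectI:
  assumes "X \<in> Obj A" "Ident A X = Zero A X X"
  shows "X = zero_obj A"
proof (rule zero_obj_eqI)
  have "f = Zero A X Y" if "f \<in> Hom A X Y" for f Y
    using Comp_Ident_right[OF that] Comp_Zero_right[OF that assms(1)] assms by simp
  moreover have "f = Zero A Y X" if "f \<in> Hom A Y X" for f Y
    using Comp_Ident_left[OF that] Comp_Zero_left[OF that assms(1)] assms by simp
  ultimately show "zero_object A X"
    unfolding zero_object_def using assms Zero_in_Hom by metis
qed

lemma Ident_zero_obj: "Ident A (zero_obj A) = Zero A (zero_obj A) (zero_obj A)"
  using Hom_to_zero_obj Ident_in_Hom zero_obj_in_Obj by blast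

end

section \<open>Matrices over the index levels\<close>

text \<open>Matrices with rows \<open>level p\<close> and columns \<open>level q\<close> whose entry at row \<open>a\<close> and column \<open>b\<close> is an
  arrow \<open>X b \<rightarrow> Y a\<close>, undefined elsewhere.\<close>

definition Mat :: "('o, 'm, 'x) cat_scheme \<Rightarrow> (index \<Rightarrow> 'o) \<Rightarrow> (index \<Rightarrow> 'o)
    \<Rightarrow> int \<Rightarrow> int \<Rightarrow> 'm matrix set"
  where "Mat A X Y p q = (\<Pi>\<^sub>E a \<in> level p. \<Pi>\<^sub>E b \<in> level q. Hom A (X b) (Y a))"

lemma Mat_entry: "M \<in> Mat A X Y p q \<Longrightarrow> a \<in> level p \<Longrightarrow> b \<in> level q \<Longrightarrow> M a b \<in> Hom A (X b) (Y a)"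
  by (auto simp: Mat_def PiE_iff)

lemma Mat_eqI:
  assumes "M \<in> Mat A X Y p q" "N \<in> Mat A X' Y' p q"
    and "\<And>a b. a \<in> level p \<Longrightarrow> b \<in> level q \<Longrightarrow> M a b = N a b"
  shows "M = N"
proof (intro ext)
  fix a b
  have "\<And>a. a \<notin> level p \<Longrightarrow> M a = N a" "\<And>a. a \<in> level p \<Longrightarrow> b \<notin> level q \<Longrightarrow> M a b = N a b"
    using assms(1,2) by (auto simp: Mat_def PiE_iff extensional_def)
  then show "M a b = N a b"
    using assms(3) by metis
qed

lemma restrict_in_Mat:
  assumes "\<And>a b. a \<in> level p \<Longrightarrow> b \<in> level q \<Longrightarrow> f a b \<in> Hom A (X b) (Y a)"
  shows "(\<lambda>a \<in> level p. \<lambda>b \<in> level q. f a b) \<in> Mat A X Y p q"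
  using assms by (simp add: Mat_def)

text \<open>Families of objects for which the sums in a matrix product are finite.\<close>

definition locally_finite :: "('o, 'm, 'x) cat_scheme \<Rightarrow> (index \<Rightarrow> 'o) \<Rightarrow> bool"
  where "locally_finite A X \<longleftrightarrow>
    (\<forall>a. X a \<in> Obj A) \<and> (\<forall>k. finite {a \<in> level k. X a \<noteq> zero_obj A})"

text \<open>The identity matrix on a level of a family of objects.\<close>

definition ident_mat :: "('o, 'm, 'x) additive_cat_scheme \<Rightarrow> (index \<Rightarrow> 'o) \<Rightarrow> int \<Rightarrow> 'm matrix"
  where "ident_mat A X k = (\<lambda>a \<in> level k. \<lambda>b \<in> level k.
    if a = b then Ident A (X a) else Zero A (X b) (X a))"

context additive_category_unique_zero
begin

lemma ident_mat_in_Mat: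
  assumes "\<And>a. X a \<in> Obj A"
  shows "ident_mat A X k \<in> Mat A X X k k"
  unfolding ident_mat_def using assms by (intro restrict_in_Mat) (simp add: Ident_in_Hom Zero_in_Hom)

text \<open>An entry of a matrix product is a sum over any finite set of middle indices outside of which
  the terms vanish.\<close>

lemma mat_mult_sum:
  assumes M: "M \<in> Mat A Y Z p q" and N: "N \<in> Mat A X Y q r" and ab: "a \<in> level p" "b \<in> level r"
    and obj: "X b \<in> Obj A" "Z a \<in> Obj A"
    and F: "finite F" "F \<subseteq> level q"
      "\<And>c. c \<in> level q - F \<Longrightarrow> M a c \<cdot> N c b = Zero A (X b) (Z a)"
  shows "mat_mult A X Z p q r M N a b = finprod (Hom_group A (X b) (Z a)) (\<lambda>c. M a c \<cdot> N c b) F"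
proof -
  have "M a c \<cdot> N c b \<in> Hom A (X b) (Z a)" if "c \<in> F" for c
    using Comp_in_Hom Mat_entry[OF M ab(1)] Mat_entry[OF N _ ab(2)] that F by blast
  then show ?thesis
    unfolding mat_mult_def using ab hom_sum_eq_sum[OF obj F(1,2) _ F(3)] by simp
qed

lemma mat_mult_entry:
  assumes M: "M \<in> Mat A Y Z p q" and N: "N \<in> Mat A X Y q r" and ab: "a \<in> level p" "b \<in> level r"
    and Y: "locally_finite A Y" and obj: "X b \<in> Obj A" "Z a \<in> Obj A"
  shows "mat_mult A X Z p q r M N a b =
    finprod (Hom_group A (X b) (Z a)) (\<lambda>c. M a c \<cdot> N c b) {c \<in> level q. Y c \<noteq> zero_obj A}"
proof (rule mat_mult_sum[OF M N ab obj])
  fix c assume c: "c \<in> level q - {c \<in> level q. Y c \<noteq> zero_obj A}"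
  then have "M a c = Zero A (Y c) (Z a)"
    using Hom_zero_obj_unique[OF Mat_entry[OF M ab(1)] Zero_in_Hom] obj Y by (auto simp: locally_finite_def)
  then show "M a c \<cdot> N c b = Zero A (X b) (Z a)"
    using Comp_Zero_left[OF Mat_entry[OF N _ ab(2)] obj(2), of c] c by simp
qed (use Y in \<open>auto simp: locally_finite_def\<close>)

lemma mat_mult_in_Mat:
  assumes M: "M \<in> Mat A Y Z p q" and N: "N \<in> Mat A X Y q r"
    and obj: "\<And>b. X b \<in> Obj A" "\<And>a. Z a \<in> Obj A"
  shows "mat_mult A X Z p q r M N \<in> Mat A X Z p r"
  unfolding mat_mult_def
proof (rule restrict_in_Mat)
  fix a b assume ab: "a \<in> level p" "b \<in> level r"
  have "M a c \<cdot> N c b \<in> Hom A (X b) (Z a)" if "c \<in> level q" for c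
    using Comp_in_Hom Mat_entry[OF M ab(1) that] Mat_entry[OF N that ab(2)] by blast
  then show "hom_sum A (X b) (Z a) (\<lambda>c. M a c \<cdot> N c b) (level q) \<in> Hom A (X b) (Z a)"
    unfolding hom_sum_def using obj by (intro sum_in_Hom) auto
qed

lemma mat_mult_assoc:
  assumes M: "M \<in> Mat A Z W p q" and N: "N \<in> Mat A Y Z q r" and R: "R \<in> Mat A X Y r s"
    and fin: "locally_finite A Y" "locally_finite A Z"
    and obj: "\<And>b. X b \<in> Obj A" "\<And>a. W a \<in> Obj A"
  shows "mat_mult A X W p r s (mat_mult A Y W p q r M N) R
    = mat_mult A X W p q s M (mat_mult A X Z q r s N R)"
proof -
  have objYZ: "Y a \<in> Obj A" "Z a \<in> Obj A" for a using fin by (auto simp: locally_finite_def)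
  have MN: "mat_mult A Y W p q r M N \<in> Mat A Y W p r"
    by (rule mat_mult_in_Mat[OF M N]) (use obj objYZ in auto)
  have NR: "mat_mult A X Z q r s N R \<in> Mat A X Z q s"
    by (rule mat_mult_in_Mat[OF N R]) (use obj objYZ in auto)
  show ?thesis
  proof (rule Mat_eqI)
    show "mat_mult A X W p r s (mat_mult A Y W p q r M N) R \<in> Mat A X W p s"
      by (rule mat_mult_in_Mat[OF MN R]) (use obj in auto)
    show "mat_mult A X W p q s M (mat_mult A X Z q r s N R) \<in> Mat A X W p s"
      by (rule mat_mult_in_Mat[OF M NR]) (use obj in auto)
    fix a b assume ab: "a \<in> level p" "b \<in> level s"
    let ?FY = "{c \<in> level r. Y c \<noteq> zero_obj A}" and ?FZ = "{c \<in> level q. Z c \<noteq> zero_obj A}"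
    let ?S = "\<lambda>f F. finprod (Hom_group A (X b) (W a)) f F"
    have m: "M a c \<in> Hom A (Z c) (W a)" if "c \<in> level q" for c using Mat_entry[OF M ab(1) that] .
    have n: "N c d \<in> Hom A (Y d) (Z c)" if "c \<in> level q" "d \<in> level r" for c d
      using Mat_entry[OF N that] .
    have r: "R d b \<in> Hom A (X b) (Y d)" if "d \<in> level r" for d using Mat_entry[OF R that ab(2)] .
    have [simp]: "finite ?FY" "finite ?FZ" using fin by (auto simp: locally_finite_def)
    have "mat_mult A X W p r s (mat_mult A Y W p q r M N) R a b
      = ?S (\<lambda>d. mat_mult A Y W p q r M N a d \<cdot> R d b) ?FY"
      by (rule mat_mult_entry[OF MN R ab fin(1)]) (use obj in auto)
    also have "\<dots> = ?S (\<lambda>d. ?S (\<lambda>c. M a c \<cdot> (N c d \<cdot> R d b)) ?FZ) ?FY"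
    proof (rule sum_cong)
      fix d assume d: "d \<in> ?FY"
      have "mat_mult A Y W p q r M N a d
        = finprod (Hom_group A (Y d) (W a)) (\<lambda>c. M a c \<cdot> N c d) ?FZ"
        by (rule mat_mult_entry[OF M N ab(1) _ fin(2)]) (use d obj objYZ in auto)
      then have "mat_mult A Y W p q r M N a d \<cdot> R d b = ?S (\<lambda>c. (M a c \<cdot> N c d) \<cdot> R d b) ?FZ"
        using Comp_sum_left[OF r obj(2), where g = "\<lambda>c. M a c \<cdot> N c d" and S = ?FZ] d
          Comp_in_Hom[OF n m] by auto
      also have "\<dots> = ?S (\<lambda>c. M a c \<cdot> (N c d \<cdot> R d b)) ?FZ"
        by (rule sum_cong) (use d m n r obj in \<open>auto intro!: Comp_in_Hom Comp_assoc\<close>)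
      finally show "mat_mult A Y W p q r M N a d \<cdot> R d b = ?S (\<lambda>c. M a c \<cdot> (N c d \<cdot> R d b)) ?FZ" .
    qed (use m n r obj in \<open>auto intro!: sum_in_Hom Comp_in_Hom\<close>)
    also have "\<dots> = ?S (\<lambda>c. ?S (\<lambda>d. M a c \<cdot> (N c d \<cdot> R d b)) ?FY) ?FZ"
      by (rule sum_swap) (use m n r obj in \<open>auto intro!: Comp_in_Hom\<close>)
    also have "\<dots> = ?S (\<lambda>c. M a c \<cdot> mat_mult A X Z q r s N R c b) ?FZ"
    proof (rule sum_cong)
      fix c assume c: "c \<in> ?FZ"
      have "mat_mult A X Z q r s N R c b
        = finprod (Hom_group A (X b) (Z c)) (\<lambda>d. N c d \<cdot> R d b) ?FY"
        by (rule mat_mult_entry[OF N R _ ab(2) fin(1)]) (use c obj objYZ in auto)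
      then show "?S (\<lambda>d. M a c \<cdot> (N c d \<cdot> R d b)) ?FY = M a c \<cdot> mat_mult A X Z q r s N R c b"
        using Comp_sum_right[OF m obj(1), of c "\<lambda>d. N c d \<cdot> R d b" ?FY b] c n r Comp_in_Hom by force
    qed (use m Mat_entry[OF NR _ ab(2)] obj in \<open>auto intro!: Comp_in_Hom\<close>)
    also have "\<dots> = mat_mult A X W p q s M (mat_mult A X Z q r s N R) a b"
      by (rule mat_mult_entry[OF M NR ab fin(2), symmetric]) (use obj in auto)
    finally show "mat_mult A X W p r s (mat_mult A Y W p q r M N) R a b
      = mat_mult A X W p q s M (mat_mult A X Z q r s N R) a b" .
  qed
qed

lemma mat_mult_ident_left:
  assumes N: "N \<in> Mat A X Y p q" and obj: "\<And>b. X b \<in> Obj A" "\<And>a. Y a \<in> Obj A"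
  shows "mat_mult A X Y p p q (ident_mat A Y p) N = N"
proof (rule Mat_eqI[OF _ N])
  have I: "ident_mat A Y p \<in> Mat A Y Y p p" using obj by (rule_tac ident_mat_in_Mat)
  then show "mat_mult A X Y p p q (ident_mat A Y p) N \<in> Mat A X Y p q"
    by (rule mat_mult_in_Mat[OF _ N]) (use obj in auto)
  fix a b assume ab: "a \<in> level p" "b \<in> level q"
  have "mat_mult A X Y p p q (ident_mat A Y p) N a b
    = finprod (Hom_group A (X b) (Y a)) (\<lambda>c. ident_mat A Y p a c \<cdot> N c b) {a}"
    by (rule mat_mult_sum[OF I N ab])
      (use ab obj Comp_Zero_left[OF Mat_entry[OF N _ ab(2)]] in \<open>auto simp: ident_mat_def\<close>)
  also have "\<dots> = N a b"
    using ab Mat_entry[OF N ab] Comp_Ident_left by (subst sum_singleton) (auto simp: ident_mat_def)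
  finally show "mat_mult A X Y p p q (ident_mat A Y p) N a b = N a b" .
qed

lemma mat_mult_ident_right:
  assumes N: "N \<in> Mat A X Y p q" and obj: "\<And>b. X b \<in> Obj A" "\<And>a. Y a \<in> Obj A"
  shows "mat_mult A X Y p q q N (ident_mat A X q) = N"
proof (rule Mat_eqI[OF _ N])
  have I: "ident_mat A X q \<in> Mat A X X q q" using obj by (rule_tac ident_mat_in_Mat)
  then show "mat_mult A X Y p q q N (ident_mat A X q) \<in> Mat A X Y p q"
    by (rule mat_mult_in_Mat[OF N]) (use obj in auto)
  fix a b assume ab: "a \<in> level p" "b \<in> level q"
  have "mat_mult A X Y p q q N (ident_mat A X q) a b
    = finprod (Hom_group A (X b) (Y a)) (\<lambda>c. N a c \<cdot> ident_mat A X q c b) {b}"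
    by (rule mat_mult_sum[OF N I ab])
      (use ab obj Comp_Zero_right[OF Mat_entry[OF N ab(1)]] in \<open>auto simp: ident_mat_def\<close>)
  also have "\<dots> = N a b"
    using ab Mat_entry[OF N ab] Comp_Ident_right by (subst sum_singleton) (auto simp: ident_mat_def)
  finally show "mat_mult A X Y p q q N (ident_mat A X q) a b = N a b" .
qed

end

section \<open>Heights and splittings of indices\<close>

lemma ht_eq_sum:
  assumes "finite S" "Poly_Mapping.keys a \<subseteq> S"
  shows "ht a = (\<Sum>i \<in> S. Poly_Mapping.lookup a i)"
  unfolding ht_def using assms by (intro sum.mono_neutral_left) (auto simp: in_keys_iff)

lemma ht_add: "ht (a + b) = ht a + ht b"
proof -
  let ?S = "Poly_Mapping.keys a \<union> Poly_Mapping.keys b"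
  have "ht (a + b) = (\<Sum>i \<in> ?S. Poly_Mapping.lookup (a + b) i)"
    by (rule ht_eq_sum) (auto simp: in_keys_iff lookup_add)
  moreover have "ht a = (\<Sum>i \<in> ?S. Poly_Mapping.lookup a i)" "ht b = (\<Sum>i \<in> ?S. Poly_Mapping.lookup b i)"
    by (rule ht_eq_sum; simp)+
  ultimately show ?thesis by (simp add: lookup_add sum.distrib)
qed

lemma ht_unit [simp]: "ht (\<epsilon> i) = 1"
  by (simp add: ht_def)

lemma ht_zero [simp]: "ht 0 = 0"
  by (simp add: ht_def)

lemma ht_diff_unit: "ht (a - \<epsilon> i) = ht a - 1"
  using ht_add[of "a - \<epsilon> i" "\<epsilon> i"] by simp

lemma unit_index_inject [simp]: "\<epsilon> i = \<epsilon> j \<longleftrightarrow> i = j"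
  by (metis lookup_single_eq lookup_single_not_eq zero_neq_one)

lemmas lookup_trunc = trunc.rep_eq
lemmas lookup_shift = shift.rep_eq

lemma trunc_add: "\<pi> n (a + b) = \<pi> n a + \<pi> n b"
  by (rule poly_mapping_eqI) (simp add: lookup_trunc lookup_add)

lemma shift_add: "\<sigma> n (a + b) = \<sigma> n a + \<sigma> n b"
  by (rule poly_mapping_eqI) (simp add: lookup_shift lookup_add)

lemma trunc_diff: "\<pi> n (a - b) = \<pi> n a - \<pi> n b"
  by (rule poly_mapping_eqI) (simp add: lookup_trunc lookup_minus)

lemma shift_diff: "\<sigma> n (a - b) = \<sigma> n a - \<sigma> n b"
  by (rule poly_mapping_eqI) (simp add: lookup_shift lookup_minus)

lemma trunc_unit: "\<pi> n (\<epsilon> i) = (if i < n then \<epsilon> i else 0)"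
  by (rule poly_mapping_eqI) (auto simp: lookup_trunc lookup_single when_def)

lemma shift_unit: "\<sigma> n (\<epsilon> i) = (if i < n then 0 else \<epsilon> (i - n))"
  by (rule poly_mapping_eqI) (auto simp: lookup_shift lookup_single when_def)

lemma trunc_0 [simp]: "\<pi> 0 a = 0"
  by (rule poly_mapping_eqI) (simp add: lookup_trunc)

lemma shift_0 [simp]: "\<sigma> 0 a = a"
  by (rule poly_mapping_eqI) (simp add: lookup_shift)

lemma trunc_trunc: "\<pi> n (\<pi> (n + m) a) = \<pi> n a"
  by (rule poly_mapping_eqI) (simp add: lookup_trunc)

lemma shift_trunc: "\<sigma> n (\<pi> (n + m) a) = \<pi> m (\<sigma> n a)"
  by (rule poly_mapping_eqI) (simp add: lookup_trunc lookup_shift)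

lemma shift_shift: "\<sigma> m (\<sigma> n a) = \<sigma> (n + m) a"
  by (rule poly_mapping_eqI) (simp add: lookup_shift add_ac)

lemma ht_trunc_shift: "ht (\<pi> n a) + ht (\<sigma> n a) = ht a"
proof -
  have "Poly_Mapping.keys (\<pi> n a) = Poly_Mapping.keys a \<inter> {..<n}" by (auto simp: in_keys_iff lookup_trunc split: if_splits)
  then have "ht (\<pi> n a) = (\<Sum>i \<in> Poly_Mapping.keys a \<inter> {..<n}. Poly_Mapping.lookup a i)"
    by (simp add: ht_def lookup_trunc)
  moreover have "Poly_Mapping.keys a - {..<n} = (\<lambda>i. i + n) ` Poly_Mapping.keys (\<sigma> n a)"
  proof
    show "Poly_Mapping.keys a - {..<n} \<subseteq> (\<lambda>i. i + n) ` Poly_Mapping.keys (\<sigma> n a)"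
    proof
      fix i assume "i \<in> Poly_Mapping.keys a - {..<n}"
      then have "i = (i - n) + n" "i - n \<in> Poly_Mapping.keys (\<sigma> n a)" by (auto simp: in_keys_iff lookup_shift)
      then show "i \<in> (\<lambda>i. i + n) ` Poly_Mapping.keys (\<sigma> n a)" by (rule image_eqI)
    qed
  qed (auto simp: in_keys_iff lookup_shift)
  then have "(\<Sum>i \<in> Poly_Mapping.keys a - {..<n}. Poly_Mapping.lookup a i) = ht (\<sigma> n a)"
    by (simp add: ht_def lookup_shift sum.reindex inj_on_def)
  ultimately show ?thesis
    using sum.Int_Diff[of "Poly_Mapping.keys a" "Poly_Mapping.lookup a" "{..<n}"] by (simp add: ht_def)
qed

lemma trunc_shift_eq_iff: "\<pi> n a = \<pi> n b \<and> \<sigma> n a = \<sigma> n b \<longleftrightarrow> a = b"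
proof
  assume *: "\<pi> n a = \<pi> n b \<and> \<sigma> n a = \<sigma> n b"
  show "a = b"
  proof (rule poly_mapping_eqI)
    fix i
    have "Poly_Mapping.lookup (\<pi> n a) i = Poly_Mapping.lookup (\<pi> n b) i"
      "Poly_Mapping.lookup (\<sigma> n a) (i - n) = Poly_Mapping.lookup (\<sigma> n b) (i - n)" using * by simp_all
    then show "Poly_Mapping.lookup a i = Poly_Mapping.lookup b i"
      by (cases "i < n") (simp_all add: lookup_trunc lookup_shift)
  qed
qed simp

text \<open>The index that consists of the first \<open>n\<close> entries of \<open>p\<close>, followed by the entries of \<open>q\<close>.\<close>

lift_definition join :: "nat \<Rightarrow> index \<Rightarrow> index \<Rightarrow> index"
  is "\<lambda>n p q i. if i < n then p i else q (i - n)"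
proof -
  fix n and p q :: "nat \<Rightarrow> int"
  assume "finite {i. p i \<noteq> 0}" "finite {i. q i \<noteq> 0}"
  moreover have "{i. (if i < n then p i else q (i - n)) \<noteq> 0}
    \<subseteq> {i. p i \<noteq> 0} \<union> (\<lambda>i. i + n) ` {i. q i \<noteq> 0}"
  proof
    fix i assume "i \<in> {i. (if i < n then p i else q (i - n)) \<noteq> 0}"
    then show "i \<in> {i. p i \<noteq> 0} \<union> (\<lambda>i. i + n) ` {i. q i \<noteq> 0}"
      by (cases "i < n") (auto intro!: image_eqI[of i _ "i - n"])
  qed
  ultimately show "finite {i. (if i < n then p i else q (i - n)) \<noteq> 0}"
    by (meson finite_UnI finite_imageI finite_subset)
qed

lemma trunc_join: "\<pi> n (join n p q) = \<pi> n p"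
  by (rule poly_mapping_eqI) (simp add: lookup_trunc join.rep_eq)

lemma shift_join: "\<sigma> n (join n p q) = q"
  by (rule poly_mapping_eqI) (simp add: lookup_shift join.rep_eq)

lemma join_trunc_shift: "join n (\<pi> n a) (\<sigma> n a) = a"
  by (rule poly_mapping_eqI) (simp add: lookup_shift lookup_trunc join.rep_eq)

section \<open>The category of pyramids\<close>

lemma pyramidD:
  assumes "is_pyramid A P"
  shows pyramid_ob_in_Obj: "ob P a \<in> Obj A"
    and pyramid_df_in_Hom: "df P a i \<in> Hom A (ob P a) (ob P (a + \<epsilon> i))"
    and pyramid_zero_beyond_len:
      "i \<ge> len P \<Longrightarrow> Poly_Mapping.lookup a i \<noteq> 0 \<Longrightarrow> ob P a = zero_obj A"
    and pyramid_zero_large: "\<exists>m. \<forall>a i. Poly_Mapping.lookup a i \<ge> m \<longrightarrow> ob P a = zero_obj A"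
    and pyramid_df_df:
      "df P (a + \<epsilon> i) i \<cdot>\<^bsub>A\<^esub> df P a i = Zero A (ob P a) (ob P (a + \<epsilon> i + \<epsilon> i))"
    and pyramid_df_anticommute:
      "df P (a + \<epsilon> i) j \<cdot>\<^bsub>A\<^esub> df P a i = Neg A (df P (a + \<epsilon> j) i \<cdot>\<^bsub>A\<^esub> df P a j)"
  using assms unfolding is_pyramid_def by (meson not_less)+

text \<open>A nonzero object of a pyramid sits at an index that is supported below its length.\<close>

lemma pyramid_nonzero_trunc:
  assumes "is_pyramid A P" "ob P a \<noteq> zero_obj A"
  shows "\<pi> (len P) a = a"
  using pyramid_zero_beyond_len[OF assms(1)] assms(2)
  by (intro poly_mapping_eqI) (auto simp: lookup_trunc not_less)

lemma pyramid_nonzero_shift: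
  assumes "is_pyramid A P" "ob P a \<noteq> zero_obj A"
  shows "\<sigma> (len P) a = 0"
proof (rule poly_mapping_eqI)
  fix i
  show "Poly_Mapping.lookup (\<sigma> (len P) a) i = Poly_Mapping.lookup 0 i"
    using pyramid_zero_beyond_len[OF assms(1), of "i + len P" a] assms(2) by (auto simp: lookup_shift)
qed

lemma pyramid_locally_finite: "is_pyramid A P \<Longrightarrow> locally_finite A (ob P)"
  using finite_level_support[of A P] pyramid_ob_in_Obj[of A P] by (simp add: locally_finite_def)

lemma is_pyramid_mor_Mat:
  "is_pyramid_mor A \<alpha> \<longleftrightarrow> is_pyramid A (src \<alpha>) \<and> is_pyramid A (tgt \<alpha>) \<and>
    (\<forall>k. mat \<alpha> k \<in> Mat A (ob (src \<alpha>)) (ob (tgt \<alpha>)) k k) \<and>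
    (\<forall>k. mat_mult A (ob (src \<alpha>)) (ob (tgt \<alpha>)) (k + 1) (k + 1) k (mat \<alpha> (k + 1)) (df_mat A (src \<alpha>) k)
       = mat_mult A (ob (src \<alpha>)) (ob (tgt \<alpha>)) (k + 1) k k (df_mat A (tgt \<alpha>) k) (mat \<alpha> k))"
  unfolding is_pyramid_mor_def Mat_def ..

lemma pyramid_ident_alt: "pyramid_ident A P = \<lparr>src = P, tgt = P, mat = ident_mat A (ob P)\<rparr>"
  by (simp add: pyramid_ident_def ident_mat_def fun_eq_iff)

lemma df_mat_unit: "b \<in> level k \<Longrightarrow> df_mat A P k (b + \<epsilon> i) b = df P b i"
  by (simp add: df_mat_def level_def ht_add)

context additive_category_unique_zero
begin

lemma df_mat_in_Mat:
  assumes P: "is_pyramid A P"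
  shows "df_mat A P k \<in> Mat A (ob P) (ob P) (k + 1) k"
  unfolding df_mat_def
proof (rule restrict_in_Mat)
  fix a b :: index
  show "(if \<exists>i. a = b + \<epsilon> i then df P b (THE i. a = b + \<epsilon> i) else Zero A (ob P b) (ob P a))
    \<in> Hom A (ob P b) (ob P a)"
    using pyramid_df_in_Hom[OF P, of b] pyramid_ob_in_Obj[OF P] by (auto simp: Zero_in_Hom)
qed

lemma pyramid_mor_ident:
  assumes "is_pyramid A P"
  shows "is_pyramid_mor A (pyramid_ident A P)"
  using assms mat_mult_ident_left mat_mult_ident_right df_mat_in_Mat[OF assms]
    pyramid_ob_in_Obj[OF assms] ident_mat_in_Mat
  by (simp add: is_pyramid_mor_Mat pyramid_ident_alt)

lemma pyramid_mor_comp: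
  assumes \<alpha>: "is_pyramid_mor A \<alpha>" and \<beta>: "is_pyramid_mor A \<beta>" and eq: "tgt \<alpha> = src \<beta>"
  shows "is_pyramid_mor A (pyramid_comp A \<beta> \<alpha>)"
proof -
  let ?X = "ob (src \<alpha>)" and ?Y = "ob (tgt \<alpha>)" and ?Z = "ob (tgt \<beta>)"
  note pyr = \<alpha>[unfolded is_pyramid_mor_Mat] \<beta>[unfolded is_pyramid_mor_Mat, folded eq]
  have P: "is_pyramid A (src \<alpha>)" "is_pyramid A (tgt \<alpha>)" "is_pyramid A (tgt \<beta>)" using pyr by auto
  have mat: "mat \<alpha> k \<in> Mat A ?X ?Y k k" "mat \<beta> k \<in> Mat A ?Y ?Z k k" for k using pyr by auto
  note fin = P[THEN pyramid_locally_finite] and obj = P[THEN pyramid_ob_in_Obj]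
    and df = P[THEN df_mat_in_Mat]
  have "mat_mult A ?X ?Z (k + 1) (k + 1) k
      (mat_mult A ?X ?Z (k + 1) (k + 1) (k + 1) (mat \<beta> (k + 1)) (mat \<alpha> (k + 1))) (df_mat A (src \<alpha>) k)
    = mat_mult A ?X ?Z (k + 1) k k (df_mat A (tgt \<beta>) k) (mat_mult A ?X ?Z k k k (mat \<beta> k) (mat \<alpha> k))" for k
  proof -
    have "mat_mult A ?X ?Z (k + 1) (k + 1) k
        (mat_mult A ?X ?Z (k + 1) (k + 1) (k + 1) (mat \<beta> (k + 1)) (mat \<alpha> (k + 1))) (df_mat A (src \<alpha>) k)
      = mat_mult A ?X ?Z (k + 1) (k + 1) k (mat \<beta> (k + 1))
        (mat_mult A ?X ?Y (k + 1) (k + 1) k (mat \<alpha> (k + 1)) (df_mat A (src \<alpha>) k))"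
      by (rule mat_mult_assoc[OF mat(2,1) df(1) fin(1,2) obj(1,3)])
    also have "\<dots> = mat_mult A ?X ?Z (k + 1) (k + 1) k (mat \<beta> (k + 1))
        (mat_mult A ?X ?Y (k + 1) k k (df_mat A (tgt \<alpha>) k) (mat \<alpha> k))"
      using pyr by simp
    also have "\<dots> = mat_mult A ?X ?Z (k + 1) k k
        (mat_mult A ?Y ?Z (k + 1) (k + 1) k (mat \<beta> (k + 1)) (df_mat A (tgt \<alpha>) k)) (mat \<alpha> k)"
      by (rule mat_mult_assoc[OF mat(2) df(2) mat(1) fin(2,2) obj(1,3), symmetric])
    also have "\<dots> = mat_mult A ?X ?Z (k + 1) k k
        (mat_mult A ?Y ?Z (k + 1) k k (df_mat A (tgt \<beta>) k) (mat \<beta> k)) (mat \<alpha> k)"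
      using pyr by simp
    also have "\<dots> = mat_mult A ?X ?Z (k + 1) k k (df_mat A (tgt \<beta>) k)
        (mat_mult A ?X ?Z k k k (mat \<beta> k) (mat \<alpha> k))"
      by (rule mat_mult_assoc[OF df(3) mat(2,1) fin(2,3) obj(1,3)])
    finally show ?thesis .
  qed
  then show ?thesis
    using P mat_mult_in_Mat[OF mat(2,1) obj(1,3)]
    by (simp add: is_pyramid_mor_Mat pyramid_comp_def)
qed

lemma Hom_pyramid_category:
  "\<alpha> \<in> Hom (pyramid_category A) P Q \<longleftrightarrow> is_pyramid_mor A \<alpha> \<and> src \<alpha> = P \<and> tgt \<alpha> = Q"
  by (auto simp: Hom_def pyramid_category_def)

lemma pyramid_mor_Mat:
  assumes "is_pyramid_mor A \<alpha>"
  shows "mat \<alpha> k \<in> Mat A (ob (src \<alpha>)) (ob (tgt \<alpha>)) k k"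
  using assms by (simp add: is_pyramid_mor_Mat)

lemma pyramid_mor_src_tgt:
  assumes "is_pyramid_mor A \<alpha>"
  shows "is_pyramid A (src \<alpha>)" and "is_pyramid A (tgt \<alpha>)"
  using assms by (simp_all add: is_pyramid_mor_Mat)

lemma category_pyramid_category: "category (pyramid_category A)"
proof
  fix \<alpha> assume "\<alpha> \<in> Arr (pyramid_category A)"
  then show "Dom (pyramid_category A) \<alpha> \<in> Obj (pyramid_category A)"
    "Cod (pyramid_category A) \<alpha> \<in> Obj (pyramid_category A)"
    by (simp_all add: pyramid_category_def pyramid_mor_src_tgt)
next
  fix P assume "P \<in> Obj (pyramid_category A)"
  then show "Ident (pyramid_category A) P \<in> Hom (pyramid_category A) P P"
    unfolding Hom_pyramid_category
    by (simp add: pyramid_category_def pyramid_mor_ident) (simp add: pyramid_ident_def)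
next
  fix \<alpha> \<beta> P Q R
  assume "\<alpha> \<in> Hom (pyramid_category A) P Q" "\<beta> \<in> Hom (pyramid_category A) Q R"
  then show "\<beta> \<cdot>\<^bsub>pyramid_category A\<^esub> \<alpha> \<in> Hom (pyramid_category A) P R"
    unfolding Hom_pyramid_category
    by (simp add: pyramid_category_def pyramid_mor_comp) (simp add: pyramid_comp_def)
next
  fix \<alpha> P Q assume "\<alpha> \<in> Hom (pyramid_category A) P Q"
  then have \<alpha>: "is_pyramid_mor A \<alpha>" "src \<alpha> = P" "tgt \<alpha> = Q" by (simp_all add: Hom_pyramid_category)
  note obj = pyramid_mor_src_tgt[OF \<alpha>(1), THEN pyramid_ob_in_Obj]
  show "Ident (pyramid_category A) Q \<cdot>\<^bsub>pyramid_category A\<^esub> \<alpha> = \<alpha>"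
    using \<alpha> mat_mult_ident_left[OF pyramid_mor_Mat[OF \<alpha>(1)] obj]
    by (auto simp: pyramid_category_def pyramid_comp_def pyramid_ident_alt)
  show "\<alpha> \<cdot>\<^bsub>pyramid_category A\<^esub> Ident (pyramid_category A) P = \<alpha>"
    using \<alpha> mat_mult_ident_right[OF pyramid_mor_Mat[OF \<alpha>(1)] obj]
    by (auto simp: pyramid_category_def pyramid_comp_def pyramid_ident_alt)
next
  fix \<alpha> \<beta> \<gamma> P Q R S
  assume "\<alpha> \<in> Hom (pyramid_category A) P Q" "\<beta> \<in> Hom (pyramid_category A) Q R"
    "\<gamma> \<in> Hom (pyramid_category A) R S"
  then have m: "is_pyramid_mor A \<alpha>" "is_pyramid_mor A \<beta>" "is_pyramid_mor A \<gamma>"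
    and eq: "tgt \<alpha> = src \<beta>" "tgt \<beta> = src \<gamma>"
    by (simp_all add: Hom_pyramid_category)
  note pyr = m[THEN pyramid_mor_src_tgt(1)] m[THEN pyramid_mor_src_tgt(2)]
  show "(\<gamma> \<cdot>\<^bsub>pyramid_category A\<^esub> \<beta>) \<cdot>\<^bsub>pyramid_category A\<^esub> \<alpha>
    = \<gamma> \<cdot>\<^bsub>pyramid_category A\<^esub> (\<beta> \<cdot>\<^bsub>pyramid_category A\<^esub> \<alpha>)"
    using mat_mult_assoc[OF m(3)[THEN pyramid_mor_Mat] m(2)[THEN pyramid_mor_Mat, unfolded eq(2)]
        m(1)[THEN pyramid_mor_Mat, unfolded eq]]
      eq pyr[THEN pyramid_locally_finite] pyr[THEN pyramid_ob_in_Obj]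
    by (simp add: pyramid_category_def pyramid_comp_def)
qed

end

section \<open>Additive strict monoidal categories\<close>

text \<open>An additive category with a single zero object and a biadditive strict tensor product.\<close>

locale additive_monoidal_category =
  additive_category_unique_zero A + strict_monoidal_category A T
  for A :: "('o, 'm, 'x) additive_cat_scheme" (structure)
    and T :: "('o, 'm, 'y) tensor_structure_scheme" (structure) +
  assumes biadditive: "biadditive_tensor A T"
begin

lemma TensA_additive_left:
  assumes "g \<in> Hom A Y Y'"
  shows "(\<lambda>f. f \<odot>\<^sub>0\<^bsub>T\<^esub> g) \<in> hom (Hom_group A X X') (Hom_group A (X \<odot>\<^bsub>T\<^esub> Y) (X' \<odot>\<^bsub>T\<^esub> Y'))"
  using assms TensA_in_Hom biadditive unfolding biadditive_tensor_def by (intro homI) (simp, simp)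

lemma TensA_additive_right:
  assumes "f \<in> Hom A X X'"
  shows "(\<lambda>g. f \<odot>\<^sub>0\<^bsub>T\<^esub> g) \<in> hom (Hom_group A Y Y') (Hom_group A (X \<odot>\<^bsub>T\<^esub> Y) (X' \<odot>\<^bsub>T\<^esub> Y'))"
  using assms TensA_in_Hom biadditive unfolding biadditive_tensor_def by (intro homI) (simp, simp)

lemma TensA_Zero_left:
  assumes "g \<in> Hom A Y Y'" "X \<in> Obj A" "X' \<in> Obj A"
  shows "Zero A X X' \<odot>\<^sub>0\<^bsub>T\<^esub> g = Zero A (X \<odot>\<^bsub>T\<^esub> Y) (X' \<odot>\<^bsub>T\<^esub> Y')"
  using additive_Zero[OF _ _ _ _ TensA_additive_left, of X X' Y Y' g] assms
    Hom_Obj[OF assms(1)] TensO_in_Obj by simp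

lemma TensA_Zero_right:
  assumes "f \<in> Hom A X X'" "Y \<in> Obj A" "Y' \<in> Obj A"
  shows "f \<odot>\<^sub>0\<^bsub>T\<^esub> Zero A Y Y' = Zero A (X \<odot>\<^bsub>T\<^esub> Y) (X' \<odot>\<^bsub>T\<^esub> Y')"
  using additive_Zero[OF _ _ _ _ TensA_additive_right, of Y Y' X X' f] assms
    Hom_Obj[OF assms(1)] TensO_in_Obj by simp

lemma TensA_Neg_left:
  assumes "f \<in> Hom A X X'" "g \<in> Hom A Y Y'"
  shows "Neg A f \<odot>\<^sub>0\<^bsub>T\<^esub> g = Neg A (f \<odot>\<^sub>0\<^bsub>T\<^esub> g)"
  using additive_Neg[OF _ _ _ _ TensA_additive_left, of X X' Y Y' g f] assms
    Hom_Obj[OF assms(1)] Hom_Obj[OF assms(2)] TensO_in_Obj by simp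

lemma TensA_Neg_right:
  assumes "f \<in> Hom A X X'" "g \<in> Hom A Y Y'"
  shows "f \<odot>\<^sub>0\<^bsub>T\<^esub> Neg A g = Neg A (f \<odot>\<^sub>0\<^bsub>T\<^esub> g)"
  using additive_Neg[OF _ _ _ _ TensA_additive_right, of Y Y' X X' f g] assms
    Hom_Obj[OF assms(1)] Hom_Obj[OF assms(2)] TensO_in_Obj by simp

lemma TensA_sum_left:
  assumes "g \<in> Hom A Y Y'" "X \<in> Obj A" "X' \<in> Obj A" "f \<in> S \<rightarrow> Hom A X X'"
  shows "finprod (Hom_group A X X') f S \<odot>\<^sub>0\<^bsub>T\<^esub> g
    = finprod (Hom_group A (X \<odot>\<^bsub>T\<^esub> Y) (X' \<odot>\<^bsub>T\<^esub> Y')) (\<lambda>s. f s \<odot>\<^sub>0\<^bsub>T\<^esub> g) S"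
  using additive_sum[OF _ _ _ _ TensA_additive_left assms(4), of Y Y' g] assms
    Hom_Obj[OF assms(1)] TensO_in_Obj by simp

lemma TensA_sum_right:
  assumes "f \<in> Hom A X X'" "Y \<in> Obj A" "Y' \<in> Obj A" "g \<in> S \<rightarrow> Hom A Y Y'"
  shows "f \<odot>\<^sub>0\<^bsub>T\<^esub> finprod (Hom_group A Y Y') g S
    = finprod (Hom_group A (X \<odot>\<^bsub>T\<^esub> Y) (X' \<odot>\<^bsub>T\<^esub> Y')) (\<lambda>s. f \<odot>\<^sub>0\<^bsub>T\<^esub> g s) S"
  using additive_sum[OF _ _ _ _ TensA_additive_right assms(4), of X X' f] assms
    Hom_Obj[OF assms(1)] TensO_in_Obj by simp

lemma TensO_zero_obj_left:
  assumes "X \<in> Obj A"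
  shows "zero_obj A \<odot>\<^bsub>T\<^esub> X = zero_obj A"
proof (rule zero_objectI)
  show "Ident A (zero_obj A \<odot>\<^bsub>T\<^esub> X) = Zero A (zero_obj A \<odot>\<^bsub>T\<^esub> X) (zero_obj A \<odot>\<^bsub>T\<^esub> X)"
    using TensA_Ident[OF zero_obj_in_Obj assms] TensA_Zero_left[OF Ident_in_Hom[OF assms]]
    by (simp add: Ident_zero_obj zero_obj_in_Obj)
qed (use assms TensO_in_Obj zero_obj_in_Obj in blast)

lemma TensO_zero_obj_right:
  assumes "X \<in> Obj A"
  shows "X \<odot>\<^bsub>T\<^esub> zero_obj A = zero_obj A"
proof (rule zero_objectI)
  show "Ident A (X \<odot>\<^bsub>T\<^esub> zero_obj A) = Zero A (X \<odot>\<^bsub>T\<^esub> zero_obj A) (X \<odot>\<^bsub>T\<^esub> zero_obj A)"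
    using TensA_Ident[OF assms zero_obj_in_Obj] TensA_Zero_right[OF Ident_in_Hom[OF assms]]
    by (simp add: Ident_zero_obj zero_obj_in_Obj)
qed (use assms TensO_in_Obj zero_obj_in_Obj in blast)

end

section \<open>The tensor product of pyramids\<close>

lemma tensO_ob: "ob (pyramid_tensO A T P Q) a = ob P (\<pi> (len P) a) \<odot>\<^bsub>T\<^esub> ob Q (\<sigma> (len P) a)"
  by (simp add: pyramid_tensO_def Let_def)

lemma tensO_len: "len (pyramid_tensO A T P Q) = len P + len Q"
  by (simp add: pyramid_tensO_def Let_def)

lemma tensO_df_left:
  "i < len P \<Longrightarrow> df (pyramid_tensO A T P Q) a i
    = df P (\<pi> (len P) a) i \<odot>\<^sub>0\<^bsub>T\<^esub> Ident A (ob Q (\<sigma> (len P) a))"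
  by (simp add: pyramid_tensO_def Let_def)

lemma tensO_df_right:
  "df (pyramid_tensO A T P Q) a (len P + j)
    = signed A (ht (\<pi> (len P) a)) (Ident A (ob P (\<pi> (len P) a)) \<odot>\<^sub>0\<^bsub>T\<^esub> df Q (\<sigma> (len P) a) j)"
  by (simp add: pyramid_tensO_def Let_def signed_def)

lemma trunc_add_unit_left: "i < n \<Longrightarrow> \<pi> n (a + \<epsilon> i) = \<pi> n a + \<epsilon> i"
  and trunc_add_unit_right: "\<pi> n (a + \<epsilon> (n + j)) = \<pi> n a"
  and shift_add_unit_left: "i < n \<Longrightarrow> \<sigma> n (a + \<epsilon> i) = \<sigma> n a"
  and shift_add_unit_right: "\<sigma> n (a + \<epsilon> (n + j)) = \<sigma> n a + \<epsilon> j"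
  by (simp_all add: trunc_add shift_add trunc_unit shift_unit)

lemma trunc_diff_unit_left: "i < n \<Longrightarrow> \<pi> n (a - \<epsilon> i) = \<pi> n a - \<epsilon> i"
  and trunc_diff_unit_right: "\<pi> n (a - \<epsilon> (n + j)) = \<pi> n a"
  and shift_diff_unit_left: "i < n \<Longrightarrow> \<sigma> n (a - \<epsilon> i) = \<sigma> n a"
  and shift_diff_unit_right: "\<sigma> n (a - \<epsilon> (n + j)) = \<sigma> n a - \<epsilon> j"
  by (simp_all add: trunc_diff shift_diff trunc_unit shift_unit)

lemmas unit_split_simps =
  trunc_add_unit_left trunc_add_unit_right shift_add_unit_left shift_add_unit_right
  trunc_diff_unit_left trunc_diff_unit_right shift_diff_unit_left shift_diff_unit_right

lemma less_or_add_cases: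
  fixes i n :: nat
  obtains "i < n" | j where "i = n + j"
  by (metis le_add_diff_inverse not_less)

context additive_monoidal_category
begin

lemma tensO_zero_beyond_len:
  assumes P: "is_pyramid A P" and Q: "is_pyramid A Q"
    and i: "i \<ge> len P + len Q" "Poly_Mapping.lookup a i \<noteq> 0"
  shows "ob (pyramid_tensO A T P Q) a = zero_obj A"
proof -
  have "ob Q (\<sigma> (len P) a) = zero_obj A"
    using pyramid_zero_beyond_len[OF Q, of "i - len P" "\<sigma> (len P) a"] i by (simp add: lookup_shift)
  then show ?thesis
    using TensO_zero_obj_right pyramid_ob_in_Obj[OF P] by (simp add: tensO_ob)
qed

lemma tensO_zero_large:
  assumes P: "is_pyramid A P" and Q: "is_pyramid A Q"
  shows "\<exists>m. \<forall>a i. Poly_Mapping.lookup a i \<ge> m \<longrightarrow> ob (pyramid_tensO A T P Q) a = zero_obj A"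
proof -
  obtain m where m: "\<And>a i. Poly_Mapping.lookup a i \<ge> m \<Longrightarrow> ob P a = zero_obj A"
    using pyramid_zero_large[OF P] by blast
  obtain m' where m': "\<And>a i. Poly_Mapping.lookup a i \<ge> m' \<Longrightarrow> ob Q a = zero_obj A"
    using pyramid_zero_large[OF Q] by blast
  have "ob (pyramid_tensO A T P Q) a = zero_obj A" if "Poly_Mapping.lookup a i \<ge> max m m'" for a i
  proof (cases "i < len P")
    case True
    then have "ob P (\<pi> (len P) a) = zero_obj A" using m[of "\<pi> (len P) a" i] that by (simp add: lookup_trunc)
    then show ?thesis using TensO_zero_obj_left pyramid_ob_in_Obj[OF Q] by (simp add: tensO_ob)
  next
    case False
    then have "ob Q (\<sigma> (len P) a) = zero_obj A"
      using m'[of "\<sigma> (len P) a" "i - len P"] that by (simp add: lookup_shift)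
    then show ?thesis using TensO_zero_obj_right pyramid_ob_in_Obj[OF P] by (simp add: tensO_ob)
  qed
  then show ?thesis by blast
qed

lemma tensO_pyramid:
  assumes P: "is_pyramid A P" and Q: "is_pyramid A Q"
  shows "is_pyramid A (pyramid_tensO A T P Q)"
proof -
  let ?R = "pyramid_tensO A T P Q" and ?n = "len P"
  note obj = pyramid_ob_in_Obj[OF P] pyramid_ob_in_Obj[OF Q]
  note df = pyramid_df_in_Hom[OF P] pyramid_df_in_Hom[OF Q]
  note I = obj[THEN Ident_in_Hom]
  have ob: "ob ?R a \<in> Obj A" for a using obj TensO_in_Obj by (simp add: tensO_ob)
  have df_in: "df ?R a i \<in> Hom A (ob ?R a) (ob ?R (a + \<epsilon> i))" for a i
    by (cases rule: less_or_add_cases[of i ?n])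
      (auto simp: tensO_df_left tensO_df_right tensO_ob unit_split_simps
        intro!: TensA_in_Hom df I signed_in_Hom)
  \<comment> \<open>The four kinds of composites of two differentials, by the factors in which they lie; the two
    mixed kinds differ by a sign because a step in the first factor raises its height by one.\<close>
  have left_left: "df ?R (a + \<epsilon> i) j \<cdot> df ?R a i
    = (df P (\<pi> ?n a + \<epsilon> i) j \<cdot> df P (\<pi> ?n a) i) \<odot>\<^sub>0\<^bsub>T\<^esub> Ident A (ob Q (\<sigma> ?n a))"
    if "i < ?n" "j < ?n" for a i j
    using that TensA_Comp[OF df(1) df(1) I(2) I(2)] Comp_Ident_left[OF I(2)]
    by (simp add: tensO_df_left unit_split_simps)
  have right_right: "df ?R (a + \<epsilon> (?n + i)) (?n + j) \<cdot> df ?R a (?n + i)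
    = Ident A (ob P (\<pi> ?n a)) \<odot>\<^sub>0\<^bsub>T\<^esub> (df Q (\<sigma> ?n a + \<epsilon> i) j \<cdot> df Q (\<sigma> ?n a) i)" for a i j
  proof -
    note t = TensA_in_Hom[OF I(1) df(2)]
    have "df ?R (a + \<epsilon> (?n + i)) (?n + j) \<cdot> df ?R a (?n + i)
      = signed A (ht (\<pi> ?n a) + ht (\<pi> ?n a))
        ((Ident A (ob P (\<pi> ?n a)) \<odot>\<^sub>0\<^bsub>T\<^esub> df Q (\<sigma> ?n a + \<epsilon> i) j)
          \<cdot> (Ident A (ob P (\<pi> ?n a)) \<odot>\<^sub>0\<^bsub>T\<^esub> df Q (\<sigma> ?n a) i))"
      by (simp add: tensO_df_right unit_split_simps Comp_signed_left[OF t signed_in_Hom[OF t]]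
          Comp_signed_right[OF t t] signed_signed[OF Comp_in_Hom[OF t t]])
    then show ?thesis
      using TensA_Comp[OF I(1) I(1) df(2) df(2)] Comp_Ident_left[OF I(1)] by (simp add: signed_def)
  qed
  have left_right: "df ?R (a + \<epsilon> i) (?n + j) \<cdot> df ?R a i
    = signed A (ht (\<pi> ?n a) + 1) (df P (\<pi> ?n a) i \<odot>\<^sub>0\<^bsub>T\<^esub> df Q (\<sigma> ?n a) j)" if "i < ?n" for a i j
    using that TensA_Comp[OF df(1) I(1) I(2) df(2)] Comp_Ident_left[OF df(1)] Comp_Ident_right[OF df(2)]
    by (simp add: tensO_df_left tensO_df_right unit_split_simps ht_add
        Comp_signed_left[OF TensA_in_Hom[OF I(1) df(2)] TensA_in_Hom[OF df(1) I(2)]])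
  have right_left: "df ?R (a + \<epsilon> (?n + j)) i \<cdot> df ?R a (?n + j)
    = signed A (ht (\<pi> ?n a)) (df P (\<pi> ?n a) i \<odot>\<^sub>0\<^bsub>T\<^esub> df Q (\<sigma> ?n a) j)" if "i < ?n" for a i j
    using that TensA_Comp[OF I(1) df(1) df(2) I(2)] Comp_Ident_right[OF df(1)] Comp_Ident_left[OF df(2)]
    by (simp add: tensO_df_left tensO_df_right unit_split_simps
        Comp_signed_right[OF TensA_in_Hom[OF df(1) I(2)] TensA_in_Hom[OF I(1) df(2)]])
  have square: "df ?R (a + \<epsilon> i) i \<cdot> df ?R a i = Zero A (ob ?R a) (ob ?R (a + \<epsilon> i + \<epsilon> i))" for a i
  proof (cases rule: less_or_add_cases[of i ?n])
    case 1
    show ?thesis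
      unfolding left_left[OF 1 1] pyramid_df_df[OF P] TensA_Zero_left[OF I(2) obj(1) obj(1)] tensO_ob
        trunc_add_unit_left[OF 1] shift_add_unit_left[OF 1] ..
  next
    case (2 j)
    show ?thesis
      unfolding 2 right_right pyramid_df_df[OF Q] TensA_Zero_right[OF I(1) obj(2) obj(2)] tensO_ob
        trunc_add_unit_right shift_add_unit_right ..
  qed
  have anti: "df ?R (a + \<epsilon> i) j \<cdot> df ?R a i = Neg A (df ?R (a + \<epsilon> j) i \<cdot> df ?R a j)" for a i j
  proof -
    note t = TensA_in_Hom[OF df]
    consider "i < ?n" "j < ?n" | j' where "i < ?n" "j = ?n + j'" | i' where "i = ?n + i'" "j < ?n"
      | i' j' where "i = ?n + i'" "j = ?n + j'"
      by (metis less_or_add_cases)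
    then show ?thesis
    proof cases
      case 1
      have "df ?R (a + \<epsilon> i) j \<cdot> df ?R a i
        = Neg A (df P (\<pi> ?n a + \<epsilon> j) i \<cdot> df P (\<pi> ?n a) j) \<odot>\<^sub>0\<^bsub>T\<^esub> Ident A (ob Q (\<sigma> ?n a))"
        unfolding left_left[OF 1] using pyramid_df_anticommute[OF P, of "\<pi> ?n a" i j] by simp
      then show ?thesis
        unfolding left_left[OF 1(2,1)] using TensA_Neg_left[OF Comp_in_Hom[OF df(1) df(1)] I(2)] by simp
    next
      case (2 j')
      then show ?thesis by (simp add: left_right right_left Neg_signed[OF t])
    next
      case (3 i')
      then show ?thesis
        by (simp add: left_right right_left Neg_signed[OF t]) (simp add: signed_def)
    next
      case (4 i' j')
      have "df ?R (a + \<epsilon> i) j \<cdot> df ?R a i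
        = Ident A (ob P (\<pi> ?n a)) \<odot>\<^sub>0\<^bsub>T\<^esub> Neg A (df Q (\<sigma> ?n a + \<epsilon> j') i' \<cdot> df Q (\<sigma> ?n a) j')"
        unfolding 4 right_right using pyramid_df_anticommute[OF Q, of "\<sigma> ?n a" i' j'] by simp
      then show ?thesis
        unfolding 4 right_right using TensA_Neg_right[OF I(1) Comp_in_Hom[OF df(2) df(2)]] by simp
    qed
  qed
  show ?thesis
    unfolding is_pyramid_def tensO_len
  proof (intro conjI allI impI)
    show "ob ?R a = zero_obj A" if "\<not> (\<forall>i\<ge>?n + len Q. Poly_Mapping.lookup a i = 0)" for a
      using tensO_zero_beyond_len[OF P Q] that by blast
    show "\<exists>m. \<forall>a. \<not> (\<forall>i. Poly_Mapping.lookup a i < m) \<longrightarrow> ob ?R a = zero_obj A"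
      using tensO_zero_large[OF P Q] by (meson not_less)
  qed (fact ob df_in square anti)+
qed

lemma unit_pyramid: "is_pyramid A (pyramid_unit A T)"
proof -
  let ?X = "\<lambda>a. if a = 0 then Unit T else zero_obj A"
  have X: "?X a \<in> Obj A" for a using Unit_in_Obj zero_obj_in_Obj by simp
  have zero: "a = 0" if "\<And>i. Poly_Mapping.lookup a i = 0" for a :: index
    using that by (intro poly_mapping_eqI) simp
  have bound: "\<exists>m::int. \<forall>a. \<not> (\<forall>i. Poly_Mapping.lookup a i < m) \<longrightarrow> ?X a = zero_obj A"
    by (rule exI[of _ 1]) auto
  have comp: "Zero A (?X b) (?X c) \<cdot> Zero A (?X a) (?X b) = Zero A (?X a) (?X c)" for a b c
    by (rule Comp_Zero_left[OF Zero_in_Hom[OF X X] X])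
  have commute: "a + \<epsilon> i + \<epsilon> j = a + \<epsilon> j + \<epsilon> i" for a i j
    by (simp add: add_ac)
  show ?thesis
    unfolding is_pyramid_def pyramid_unit_def Let_def pyramid.simps comp Neg_Zero[OF X X]
  proof (intro conjI allI)
    show "Zero A (?X a) (?X (a + \<epsilon> i + \<epsilon> i)) = Zero A (?X a) (?X (a + \<epsilon> i + \<epsilon> i))" for a i ..
    show "Zero A (?X a) (?X (a + \<epsilon> i + \<epsilon> j)) = Zero A (?X a) (?X (a + \<epsilon> j + \<epsilon> i))" for a i j
      by (simp only: commute)
  qed (use zero bound Zero_in_Hom Unit_in_Obj zero_obj_in_Obj in auto)
qed

end

section \<open>Morphisms of pyramids entrywise\<close>

text \<open>The entry of a morphism at two indices of equal height; the level is determined by them.\<close>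

definition entry :: "('o, 'm) pyramid_mor \<Rightarrow> index \<Rightarrow> index \<Rightarrow> 'm"
  where "entry \<alpha> a b = mat \<alpha> (ht a) a b"

lemma entry_level: "a \<in> level k \<Longrightarrow> mat \<alpha> k a b = entry \<alpha> a b"
  by (simp add: entry_def level_def)

lemma entry_ident:
  "ht a = ht b \<Longrightarrow> entry (pyramid_ident A P) a b
    = (if a = b then Ident A (ob P a) else Zero A (ob P b) (ob P a))"
  by (simp add: entry_def pyramid_ident_def level_def)

lemma entry_tensA:
  assumes "ht a = ht b"
  shows "entry (pyramid_tensA A T \<alpha> \<beta>) a b =
    (if ht (\<pi> (len (tgt \<alpha>)) a) = ht (\<pi> (len (src \<alpha>)) b)
     then entry \<alpha> (\<pi> (len (tgt \<alpha>)) a) (\<pi> (len (src \<alpha>)) b)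
       \<odot>\<^sub>0\<^bsub>T\<^esub> entry \<beta> (\<sigma> (len (tgt \<alpha>)) a) (\<sigma> (len (src \<alpha>)) b)
     else Zero A (ob (pyramid_tensO A T (src \<alpha>) (src \<beta>)) b) (ob (pyramid_tensO A T (tgt \<alpha>) (tgt \<beta>)) a))"
proof -
  have *: "ht (\<sigma> n a) = ht a - ht (\<pi> n a)" for n using ht_trunc_shift[of n a] by linarith
  show ?thesis using assms by (simp add: entry_def pyramid_tensA_def level_def Let_def *)
qed

lemma src_tgt_tensA [simp]:
  "src (pyramid_tensA A T \<alpha> \<beta>) = pyramid_tensO A T (src \<alpha>) (src \<beta>)"
  "tgt (pyramid_tensA A T \<alpha> \<beta>) = pyramid_tensO A T (tgt \<alpha>) (tgt \<beta>)"
  by (simp_all add: pyramid_tensA_def Let_def)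

lemma src_tgt_ident [simp]:
  "src (pyramid_ident A P) = P" "tgt (pyramid_ident A P) = P"
  by (simp_all add: pyramid_ident_def)

lemma src_tgt_comp [simp]:
  "src (pyramid_comp A \<beta> \<alpha>) = src \<alpha>" "tgt (pyramid_comp A \<beta> \<alpha>) = tgt \<beta>"
  by (simp_all add: pyramid_comp_def)

context additive_category_unique_zero
begin

lemma entry_in_Hom:
  assumes "is_pyramid_mor A \<alpha>" "ht a = ht b"
  shows "entry \<alpha> a b \<in> Hom A (ob (src \<alpha>) b) (ob (tgt \<alpha>) a)"
  unfolding entry_def
  by (rule Mat_entry[OF pyramid_mor_Mat[OF assms(1)]]) (use assms(2) in \<open>simp_all add: level_def\<close>)

lemma pyramid_mor_eqI:
  assumes "is_pyramid_mor A \<alpha>" "is_pyramid_mor A \<beta>" "src \<alpha> = src \<beta>" "tgt \<alpha> = tgt \<beta>"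
    and "\<And>a b. ht a = ht b \<Longrightarrow> entry \<alpha> a b = entry \<beta> a b"
  shows "\<alpha> = \<beta>"
proof -
  have "mat \<alpha> k = mat \<beta> k" for k
    by (rule Mat_eqI[OF pyramid_mor_Mat[OF assms(1)] pyramid_mor_Mat[OF assms(2)]])
      (use assms(5) in \<open>simp add: entry_level, simp add: level_def\<close>)
  then show ?thesis using assms(3,4) by (intro pyramid_mor.equality) auto
qed

text \<open>Directions \<open>i \<ge> len P\<close> do not contribute to a product with the differential: one of \<open>b\<close> and
  \<open>b + \<epsilon> i\<close> has a nonzero entry at position \<open>i\<close>, so the object there is zero.\<close>

lemma mat_mult_df_mat_right:
  assumes M: "M \<in> Mat A (ob P) Y (k + 1) (k + 1)" and P: "is_pyramid A P"
    and ab: "a \<in> level (k + 1)" "b \<in> level k" and obj: "Y a \<in> Obj A"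
  shows "mat_mult A (ob P) Y (k + 1) (k + 1) k M (df_mat A P k) a b
    = finprod (Hom_group A (ob P b) (Y a)) (\<lambda>i. M a (b + \<epsilon> i) \<cdot> df P b i) {..<len P}"
proof -
  note D = df_mat_in_Mat[OF P, of k]
  have lev: "b + \<epsilon> i \<in> level (k + 1)" for i using ab by (simp add: level_def ht_add)
  have "mat_mult A (ob P) Y (k + 1) (k + 1) k M (df_mat A P k) a b
    = finprod (Hom_group A (ob P b) (Y a)) (\<lambda>c. M a c \<cdot> df_mat A P k c b) ((\<lambda>i. b + \<epsilon> i) ` {..<len P})"
  proof (rule mat_mult_sum[OF M D ab _ obj])
    fix c assume c: "c \<in> level (k + 1) - (\<lambda>i. b + \<epsilon> i) ` {..<len P}"
    have "df_mat A P k c b = Zero A (ob P b) (ob P c)"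
    proof (cases "\<exists>i. c = b + \<epsilon> i")
      case True
      then obtain i where i: "c = b + \<epsilon> i" "i \<ge> len P" using c by (metis DiffD2 imageI lessThan_iff not_less)
      then have "Poly_Mapping.lookup c i = Poly_Mapping.lookup b i + 1" by (simp add: lookup_add)
      then have "ob P b = zero_obj A \<or> ob P c = zero_obj A"
        using pyramid_zero_beyond_len[OF P i(2)] by (metis add_cancel_right_left zero_neq_one)
      then show ?thesis
        using Hom_zero_obj_unique[OF Mat_entry[OF D] Zero_in_Hom] c ab pyramid_ob_in_Obj[OF P] by blast
    next
      case False
      then show ?thesis using c ab by (simp add: df_mat_def)
    qed
    then show "M a c \<cdot> df_mat A P k c b = Zero A (ob P b) (Y a)"
      using Comp_Zero_right[OF Mat_entry[OF M ab(1)], of c] c pyramid_ob_in_Obj[OF P] by simp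
  qed (use lev pyramid_ob_in_Obj[OF P] in auto)
  also have "\<dots> = finprod (Hom_group A (ob P b) (Y a))
      (\<lambda>i. M a (b + \<epsilon> i) \<cdot> df_mat A P k (b + \<epsilon> i) b) {..<len P}"
    by (rule sum_reindex)
      (use obj pyramid_ob_in_Obj[OF P] Comp_in_Hom[OF Mat_entry[OF D lev ab(2)] Mat_entry[OF M ab(1) lev]]
        in \<open>auto intro!: inj_onI\<close>)
  finally show ?thesis by (simp add: df_mat_unit[OF ab(2)])
qed

lemma mat_mult_df_mat_left:
  assumes M: "M \<in> Mat A X (ob Q) k k" and Q: "is_pyramid A Q"
    and ab: "a \<in> level (k + 1)" "b \<in> level k" and obj: "X b \<in> Obj A"
  shows "mat_mult A X (ob Q) (k + 1) k k (df_mat A Q k) M a b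
    = finprod (Hom_group A (X b) (ob Q a)) (\<lambda>i. df Q (a - \<epsilon> i) i \<cdot> M (a - \<epsilon> i) b) {..<len Q}"
proof -
  note D = df_mat_in_Mat[OF Q, of k]
  have lev: "a - \<epsilon> i \<in> level k" for i using ab by (simp add: level_def ht_diff_unit)
  have "mat_mult A X (ob Q) (k + 1) k k (df_mat A Q k) M a b
    = finprod (Hom_group A (X b) (ob Q a)) (\<lambda>c. df_mat A Q k a c \<cdot> M c b) ((\<lambda>i. a - \<epsilon> i) ` {..<len Q})"
  proof (rule mat_mult_sum[OF D M ab obj])
    fix c assume c: "c \<in> level k - (\<lambda>i. a - \<epsilon> i) ` {..<len Q}"
    have "df_mat A Q k a c = Zero A (ob Q c) (ob Q a)"
    proof (cases "\<exists>i. a = c + \<epsilon> i")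
      case True
      then obtain i where a: "a = c + \<epsilon> i" by blast
      then have "c = a - \<epsilon> i" by simp
      then have i: "i \<ge> len Q" using c by (metis DiffD2 imageI lessThan_iff not_less)
      have "Poly_Mapping.lookup a i = Poly_Mapping.lookup c i + 1" using a by (simp add: lookup_add)
      then have "ob Q a = zero_obj A \<or> ob Q c = zero_obj A"
        using pyramid_zero_beyond_len[OF Q i] by (metis add_cancel_right_left zero_neq_one)
      then show ?thesis
        using Hom_zero_obj_unique[OF Mat_entry[OF D] Zero_in_Hom] c ab pyramid_ob_in_Obj[OF Q] by blast
    next
      case False
      then show ?thesis using c ab by (simp add: df_mat_def)
    qed
    then show "df_mat A Q k a c \<cdot> M c b = Zero A (X b) (ob Q a)"
      using Comp_Zero_left[OF Mat_entry[OF M _ ab(2)], of c] c pyramid_ob_in_Obj[OF Q] by simp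
  qed (use lev pyramid_ob_in_Obj[OF Q] in auto)
  also have "\<dots> = finprod (Hom_group A (X b) (ob Q a))
      (\<lambda>i. df_mat A Q k a (a - \<epsilon> i) \<cdot> M (a - \<epsilon> i) b) {..<len Q}"
    by (rule sum_reindex)
      (use obj pyramid_ob_in_Obj[OF Q] Comp_in_Hom[OF Mat_entry[OF M lev ab(2)] Mat_entry[OF D ab(1) lev]]
        in \<open>auto intro!: inj_onI\<close>)
  moreover have "df_mat A Q k a (a - \<epsilon> i) = df Q (a - \<epsilon> i) i" for i
    using df_mat_unit[OF lev[of i], of A Q i] by simp
  ultimately show ?thesis by (simp only:)
qed

text \<open>Compatibility with the differentials, as an identity of sums over directions instead of
  a matrix identity.\<close>

lemma is_pyramid_mor_entry:
  "is_pyramid_mor A \<alpha> \<longleftrightarrow> is_pyramid A (src \<alpha>) \<and> is_pyramid A (tgt \<alpha>) \<and>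
    (\<forall>k. mat \<alpha> k \<in> Mat A (ob (src \<alpha>)) (ob (tgt \<alpha>)) k k) \<and>
    (\<forall>a b. ht a = ht b + 1 \<longrightarrow>
      finprod (Hom_group A (ob (src \<alpha>) b) (ob (tgt \<alpha>) a))
        (\<lambda>i. entry \<alpha> a (b + \<epsilon> i) \<cdot> df (src \<alpha>) b i) {..<len (src \<alpha>)}
      = finprod (Hom_group A (ob (src \<alpha>) b) (ob (tgt \<alpha>) a))
        (\<lambda>i. df (tgt \<alpha>) (a - \<epsilon> i) i \<cdot> entry \<alpha> (a - \<epsilon> i) b) {..<len (tgt \<alpha>)})"
proof (cases "is_pyramid A (src \<alpha>) \<and> is_pyramid A (tgt \<alpha>) \<and>
    (\<forall>k. mat \<alpha> k \<in> Mat A (ob (src \<alpha>)) (ob (tgt \<alpha>)) k k)")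
  case True
  then have P: "is_pyramid A (src \<alpha>)" and Q: "is_pyramid A (tgt \<alpha>)"
    and M: "mat \<alpha> k \<in> Mat A (ob (src \<alpha>)) (ob (tgt \<alpha>)) k k" for k by auto
  let ?L = "\<lambda>k. mat_mult A (ob (src \<alpha>)) (ob (tgt \<alpha>)) (k + 1) (k + 1) k (mat \<alpha> (k + 1)) (df_mat A (src \<alpha>) k)"
  let ?R = "\<lambda>k. mat_mult A (ob (src \<alpha>)) (ob (tgt \<alpha>)) (k + 1) k k (df_mat A (tgt \<alpha>) k) (mat \<alpha> k)"
  note obj = pyramid_ob_in_Obj[OF P] pyramid_ob_in_Obj[OF Q]
  have LR: "?L k \<in> Mat A (ob (src \<alpha>)) (ob (tgt \<alpha>)) (k + 1) k"
    "?R k \<in> Mat A (ob (src \<alpha>)) (ob (tgt \<alpha>)) (k + 1) k" for k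
    using mat_mult_in_Mat[OF M df_mat_in_Mat[OF P] obj] mat_mult_in_Mat[OF df_mat_in_Mat[OF Q] M obj]
    by auto
  have "?L k = ?R k \<longleftrightarrow> (\<forall>a b. a \<in> level (k + 1) \<longrightarrow> b \<in> level k \<longrightarrow> ?L k a b = ?R k a b)" for k
    using Mat_eqI[OF LR] by metis
  moreover have "?L k a b = finprod (Hom_group A (ob (src \<alpha>) b) (ob (tgt \<alpha>) a))
        (\<lambda>i. entry \<alpha> a (b + \<epsilon> i) \<cdot> df (src \<alpha>) b i) {..<len (src \<alpha>)}"
    "?R k a b = finprod (Hom_group A (ob (src \<alpha>) b) (ob (tgt \<alpha>) a))
        (\<lambda>i. df (tgt \<alpha>) (a - \<epsilon> i) i \<cdot> entry \<alpha> (a - \<epsilon> i) b) {..<len (tgt \<alpha>)}"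
    if ab: "a \<in> level (k + 1)" "b \<in> level k" for a b k
    using mat_mult_df_mat_right[OF M P ab obj(2)] mat_mult_df_mat_left[OF M Q ab obj(1)] ab
    by (simp_all add: entry_def level_def ht_diff_unit)
  ultimately show ?thesis
    unfolding is_pyramid_mor_Mat using True by (auto simp: level_def)
qed (auto simp: is_pyramid_mor_Mat)

text \<open>Composites as sums; \<open>F\<close> is any finite set of middle indices that carries all nonzero terms.\<close>

lemma entry_comp:
  assumes \<alpha>: "is_pyramid_mor A \<alpha>" and \<beta>: "is_pyramid_mor A \<beta>" and eq: "tgt \<alpha> = src \<beta>"
    and ab: "ht a = ht b"
    and F: "finite F" "F \<subseteq> level (ht b)" "\<And>c. c \<in> level (ht b) - F \<Longrightarrow>
      entry \<beta> a c \<cdot> entry \<alpha> c b = Zero A (ob (src \<alpha>) b) (ob (tgt \<beta>) a)"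
  shows "entry (pyramid_comp A \<beta> \<alpha>) a b
    = finprod (Hom_group A (ob (src \<alpha>) b) (ob (tgt \<beta>) a)) (\<lambda>c. entry \<beta> a c \<cdot> entry \<alpha> c b) F"
proof -
  note pyr = pyramid_mor_src_tgt[OF \<alpha>] pyramid_mor_src_tgt[OF \<beta>]
  have e: "mat \<beta> (ht b) a c \<cdot> mat \<alpha> (ht b) c b = entry \<beta> a c \<cdot> entry \<alpha> c b" if "c \<in> level (ht b)" for c
    using that ab by (simp add: entry_def level_def)
  have "entry (pyramid_comp A \<beta> \<alpha>) a b
    = mat_mult A (ob (src \<alpha>)) (ob (tgt \<beta>)) (ht b) (ht b) (ht b) (mat \<beta> (ht b)) (mat \<alpha> (ht b)) a b"
    using ab by (simp add: entry_def pyramid_comp_def)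
  also have "\<dots> = finprod (Hom_group A (ob (src \<alpha>) b) (ob (tgt \<beta>) a))
      (\<lambda>c. mat \<beta> (ht b) a c \<cdot> mat \<alpha> (ht b) c b) F"
    by (rule mat_mult_sum[OF pyramid_mor_Mat[OF \<beta>] pyramid_mor_Mat[OF \<alpha>, unfolded eq]])
      (use ab F e pyr pyramid_ob_in_Obj in \<open>auto simp: level_def\<close>)
  also have "\<dots> = finprod (Hom_group A (ob (src \<alpha>) b) (ob (tgt \<beta>) a)) (\<lambda>c. entry \<beta> a c \<cdot> entry \<alpha> c b) F"
  proof (rule sum_cong)
    show "(\<lambda>c. entry \<beta> a c \<cdot> entry \<alpha> c b) \<in> F \<rightarrow> Hom A (ob (src \<alpha>) b) (ob (tgt \<beta>) a)"
    proof
      fix c assume "c \<in> F"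
      then have "ht c = ht b" using F by (auto simp: level_def)
      then show "entry \<beta> a c \<cdot> entry \<alpha> c b \<in> Hom A (ob (src \<alpha>) b) (ob (tgt \<beta>) a)"
        using entry_in_Hom[OF \<alpha>, of c b] entry_in_Hom[OF \<beta>, of a c] Comp_in_Hom ab eq by auto
    qed
  qed (use pyr pyramid_ob_in_Obj e F in auto)
  finally show ?thesis .
qed

end

section \<open>The tensor product of morphisms\<close>

context additive_monoidal_category
begin

lemma tensA_Mat:
  assumes \<alpha>: "is_pyramid_mor A \<alpha>" and \<beta>: "is_pyramid_mor A \<beta>"
  shows "mat (pyramid_tensA A T \<alpha> \<beta>) k
    \<in> Mat A (ob (pyramid_tensO A T (src \<alpha>) (src \<beta>))) (ob (pyramid_tensO A T (tgt \<alpha>) (tgt \<beta>))) k k"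
proof -
  let ?P = "pyramid_tensO A T (src \<alpha>) (src \<beta>)" and ?Q = "pyramid_tensO A T (tgt \<alpha>) (tgt \<beta>)"
  note obj = tensO_pyramid[OF pyramid_mor_src_tgt(1)[OF \<alpha>] pyramid_mor_src_tgt(1)[OF \<beta>], THEN pyramid_ob_in_Obj]
    tensO_pyramid[OF pyramid_mor_src_tgt(2)[OF \<alpha>] pyramid_mor_src_tgt(2)[OF \<beta>], THEN pyramid_ob_in_Obj]
  have "entry (pyramid_tensA A T \<alpha> \<beta>) a b \<in> Hom A (ob ?P b) (ob ?Q a)" if ab: "ht a = ht b" for a b
  proof (cases "ht (\<pi> (len (tgt \<alpha>)) a) = ht (\<pi> (len (src \<alpha>)) b)")
    case True
    then have "ht (\<sigma> (len (tgt \<alpha>)) a) = ht (\<sigma> (len (src \<alpha>)) b)"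
      using ht_trunc_shift[of "len (tgt \<alpha>)" a] ht_trunc_shift[of "len (src \<alpha>)" b] ab by linarith
    then show ?thesis
      using True TensA_in_Hom[OF entry_in_Hom[OF \<alpha> True] entry_in_Hom[OF \<beta>]]
      by (simp add: entry_tensA[OF ab] tensO_ob)
  qed (use obj Zero_in_Hom ab in \<open>simp add: entry_tensA\<close>)
  then have "(\<lambda>a \<in> level k. \<lambda>b \<in> level k. mat (pyramid_tensA A T \<alpha> \<beta>) k a b) \<in> Mat A (ob ?P) (ob ?Q) k k"
    by (intro restrict_in_Mat) (simp add: entry_level, simp add: level_def)
  moreover have "(\<lambda>a \<in> level k. \<lambda>b \<in> level k. mat (pyramid_tensA A T \<alpha> \<beta>) k a b)
    = mat (pyramid_tensA A T \<alpha> \<beta>) k"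
    by (auto simp: pyramid_tensA_def Let_def fun_eq_iff)
  ultimately show ?thesis by simp
qed

lemma tensA_mor:
  assumes \<alpha>: "is_pyramid_mor A \<alpha>" and \<beta>: "is_pyramid_mor A \<beta>"
  shows "is_pyramid_mor A (pyramid_tensA A T \<alpha> \<beta>)"
proof -
  let ?P = "src \<alpha>" and ?P' = "tgt \<alpha>" and ?Q = "src \<beta>" and ?Q' = "tgt \<beta>"
  let ?n = "len ?P" and ?n' = "len ?P'" and ?m = "len ?Q" and ?m' = "len ?Q'"
  let ?S = "pyramid_tensO A T ?P ?Q" and ?S' = "pyramid_tensO A T ?P' ?Q'" and ?\<gamma> = "pyramid_tensA A T \<alpha> \<beta>"
  note P = pyramid_mor_src_tgt[OF \<alpha>] and Q = pyramid_mor_src_tgt[OF \<beta>]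
  note S = tensO_pyramid[OF P(1) Q(1)] and S' = tensO_pyramid[OF P(2) Q(2)]
  note obj = P[THEN pyramid_ob_in_Obj] Q[THEN pyramid_ob_in_Obj] S[THEN pyramid_ob_in_Obj] S'[THEN pyramid_ob_in_Obj]
  note df = P[THEN pyramid_df_in_Hom] Q[THEN pyramid_df_in_Hom] S[THEN pyramid_df_in_Hom] S'[THEN pyramid_df_in_Hom]
  note I = obj[THEN Ident_in_Hom]
  note e = entry_in_Hom[OF \<alpha>] entry_in_Hom[OF \<beta>]
  have e\<gamma>: "entry ?\<gamma> a b \<in> Hom A (ob ?S b) (ob ?S' a)" if "ht a = ht b" for a b
    using Mat_entry[OF tensA_Mat[OF \<alpha> \<beta>], of a "ht a" b] that by (simp add: entry_def level_def)
  have "finprod (Hom_group A (ob ?S b) (ob ?S' a)) (\<lambda>i. entry ?\<gamma> a (b + \<epsilon> i) \<cdot> df ?S b i) {..<len ?S}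
    = finprod (Hom_group A (ob ?S b) (ob ?S' a)) (\<lambda>i. df ?S' (a - \<epsilon> i) i \<cdot> entry ?\<gamma> (a - \<epsilon> i) b) {..<len ?S'}"
    if ab: "ht a = ht b + 1" for a b
  proof -
    let ?\<Sigma> = "finprod (Hom_group A (ob ?S b) (ob ?S' a))"
    define pa sa where "pa = \<pi> ?n' a" and "sa = \<sigma> ?n' a"
    define pb sb where "pb = \<pi> ?n b" and "sb = \<sigma> ?n b"
    note defs = pa_def[symmetric] sa_def[symmetric] pb_def[symmetric] sb_def[symmetric]
    have ht: "ht pa + ht sa = ht a" "ht pb + ht sb = ht b"
      unfolding pa_def sa_def pb_def sb_def by (rule ht_trunc_shift)+
    have S_b: "ob ?S b = ob ?P pb \<odot>\<^bsub>T\<^esub> ob ?Q sb" and S'_a: "ob ?S' a = ob ?P' pa \<odot>\<^bsub>T\<^esub> ob ?Q' sa"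
      by (simp_all add: tensO_ob pa_def sa_def pb_def sb_def)
    have typL: "entry ?\<gamma> a (b + \<epsilon> i) \<cdot> df ?S b i \<in> Hom A (ob ?S b) (ob ?S' a)" for i
      by (rule Comp_in_Hom[OF df(5) e\<gamma>]) (simp add: ab ht_add)
    have typR: "df ?S' (a - \<epsilon> i) i \<cdot> entry ?\<gamma> (a - \<epsilon> i) b \<in> Hom A (ob ?S b) (ob ?S' a)" for i
      using Comp_in_Hom[OF e\<gamma> df(6)[of "a - \<epsilon> i" i], of b] ab by (simp add: ht_diff_unit)
    have L: "?\<Sigma> (\<lambda>i. entry ?\<gamma> a (b + \<epsilon> i) \<cdot> df ?S b i) {..<len ?S}
      = Add A (?\<Sigma> (\<lambda>i. entry ?\<gamma> a (b + \<epsilon> i) \<cdot> df ?S b i) {..<?n})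
          (?\<Sigma> (\<lambda>j. entry ?\<gamma> a (b + \<epsilon> (?n + j)) \<cdot> df ?S b (?n + j)) {..<?m})"
      unfolding tensO_len by (rule sum_split[OF obj(5,6) typL])
    have R: "?\<Sigma> (\<lambda>i. df ?S' (a - \<epsilon> i) i \<cdot> entry ?\<gamma> (a - \<epsilon> i) b) {..<len ?S'}
      = Add A (?\<Sigma> (\<lambda>i. df ?S' (a - \<epsilon> i) i \<cdot> entry ?\<gamma> (a - \<epsilon> i) b) {..<?n'})
          (?\<Sigma> (\<lambda>j. df ?S' (a - \<epsilon> (?n' + j)) (?n' + j) \<cdot> entry ?\<gamma> (a - \<epsilon> (?n' + j)) b) {..<?m'})"
      unfolding tensO_len by (rule sum_split[OF obj(5,6) typR])
    have L1_zero: "?\<Sigma> (\<lambda>i. entry ?\<gamma> a (b + \<epsilon> i) \<cdot> df ?S b i) {..<?n} = Zero A (ob ?S b) (ob ?S' a)"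
      if "ht pa \<noteq> ht pb + 1"
      by (rule sum_Zero) (use that ab obj Comp_Zero_left[OF df(5) obj(6)]
        in \<open>simp_all add: entry_tensA ht_add unit_split_simps defs\<close>)
    have R1_zero: "?\<Sigma> (\<lambda>i. df ?S' (a - \<epsilon> i) i \<cdot> entry ?\<gamma> (a - \<epsilon> i) b) {..<?n'} = Zero A (ob ?S b) (ob ?S' a)"
      if "ht pa \<noteq> ht pb + 1"
      by (rule sum_Zero) (use that ab obj Comp_Zero_right[OF df(6)[of "a - \<epsilon> _"] obj(5)]
        in \<open>simp_all add: entry_tensA ht_diff_unit unit_split_simps defs\<close>)
    have L2_zero: "?\<Sigma> (\<lambda>j. entry ?\<gamma> a (b + \<epsilon> (?n + j)) \<cdot> df ?S b (?n + j)) {..<?m}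
        = Zero A (ob ?S b) (ob ?S' a)"
      if "ht pa \<noteq> ht pb"
      by (rule sum_Zero) (use that ab obj Comp_Zero_left[OF df(5) obj(6)]
        in \<open>simp_all add: entry_tensA ht_add unit_split_simps defs\<close>)
    have R2_zero: "?\<Sigma> (\<lambda>j. df ?S' (a - \<epsilon> (?n' + j)) (?n' + j) \<cdot> entry ?\<gamma> (a - \<epsilon> (?n' + j)) b) {..<?m'}
        = Zero A (ob ?S b) (ob ?S' a)"
      if "ht pa \<noteq> ht pb"
      by (rule sum_Zero) (use that ab obj Comp_Zero_right[OF df(6)[of "a - \<epsilon> _"] obj(5)]
        in \<open>simp_all add: entry_tensA ht_diff_unit unit_split_simps defs\<close>)
    \<comment> \<open>Directions of the first factor: this is the identity for \<open>\<alpha>\<close>, tensored with an entry of \<open>\<beta>\<close>.\<close>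
    have part1: "?\<Sigma> (\<lambda>i. entry ?\<gamma> a (b + \<epsilon> i) \<cdot> df ?S b i) {..<?n}
      = ?\<Sigma> (\<lambda>i. df ?S' (a - \<epsilon> i) i \<cdot> entry ?\<gamma> (a - \<epsilon> i) b) {..<?n'}"
    proof (cases "ht pa = ht pb + 1")
      case True
      then have hs: "ht sa = ht sb" using ht ab by linarith
      have eL: "entry \<alpha> pa (pb + \<epsilon> i) \<in> Hom A (ob ?P (pb + \<epsilon> i)) (ob ?P' pa)" for i
        by (rule e) (simp add: True ht_add)
      have eR: "entry \<alpha> (pa - \<epsilon> i) pb \<in> Hom A (ob ?P pb) (ob ?P' (pa - \<epsilon> i))" for i
        by (rule e) (simp add: True ht_diff_unit)
      have dR: "df ?P' (pa - \<epsilon> i) i \<in> Hom A (ob ?P' (pa - \<epsilon> i)) (ob ?P' pa)" for i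
        using df(2)[of "pa - \<epsilon> i" i] by simp
      note es = e(2)[OF hs]
      have "?\<Sigma> (\<lambda>i. entry ?\<gamma> a (b + \<epsilon> i) \<cdot> df ?S b i) {..<?n}
        = ?\<Sigma> (\<lambda>i. (entry \<alpha> pa (pb + \<epsilon> i) \<cdot> df ?P pb i) \<odot>\<^sub>0\<^bsub>T\<^esub> entry \<beta> sa sb) {..<?n}"
      proof (rule sum_cong[OF obj(5,6)])
        fix i assume "i \<in> {..<?n}"
        then show "entry ?\<gamma> a (b + \<epsilon> i) \<cdot> df ?S b i
          = (entry \<alpha> pa (pb + \<epsilon> i) \<cdot> df ?P pb i) \<odot>\<^sub>0\<^bsub>T\<^esub> entry \<beta> sa sb"
          using ab True TensA_Comp[OF df(1) eL I(3) es] Comp_Ident_right[OF es]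
          by (simp add: entry_tensA ht_add unit_split_simps defs tensO_df_left)
      qed (use TensA_in_Hom[OF Comp_in_Hom[OF df(1) eL] es] in \<open>simp add: S_b S'_a\<close>)
      also have "\<dots> = finprod (Hom_group A (ob ?P pb) (ob ?P' pa))
          (\<lambda>i. entry \<alpha> pa (pb + \<epsilon> i) \<cdot> df ?P pb i) {..<?n} \<odot>\<^sub>0\<^bsub>T\<^esub> entry \<beta> sa sb"
        unfolding S_b S'_a using Comp_in_Hom[OF df(1) eL]
        by (intro TensA_sum_left[symmetric, OF es obj(1,2)]) simp
      also have "\<dots> = finprod (Hom_group A (ob ?P pb) (ob ?P' pa))
          (\<lambda>i. df ?P' (pa - \<epsilon> i) i \<cdot> entry \<alpha> (pa - \<epsilon> i) pb) {..<?n'} \<odot>\<^sub>0\<^bsub>T\<^esub> entry \<beta> sa sb"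
        using \<alpha> True by (simp add: is_pyramid_mor_entry)
      also have "\<dots> = ?\<Sigma> (\<lambda>i. (df ?P' (pa - \<epsilon> i) i \<cdot> entry \<alpha> (pa - \<epsilon> i) pb) \<odot>\<^sub>0\<^bsub>T\<^esub> entry \<beta> sa sb) {..<?n'}"
        unfolding S_b S'_a using Comp_in_Hom[OF eR dR] by (intro TensA_sum_left[OF es obj(1,2)]) simp
      also have "\<dots> = ?\<Sigma> (\<lambda>i. df ?S' (a - \<epsilon> i) i \<cdot> entry ?\<gamma> (a - \<epsilon> i) b) {..<?n'}"
      proof (rule sum_cong[OF obj(5,6)])
        fix i assume "i \<in> {..<?n'}"
        then show "(df ?P' (pa - \<epsilon> i) i \<cdot> entry \<alpha> (pa - \<epsilon> i) pb) \<odot>\<^sub>0\<^bsub>T\<^esub> entry \<beta> sa sb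
          = df ?S' (a - \<epsilon> i) i \<cdot> entry ?\<gamma> (a - \<epsilon> i) b"
          using ab True TensA_Comp[OF eR dR es I(4)] Comp_Ident_left[OF es]
          by (simp add: entry_tensA ht_diff_unit unit_split_simps defs tensO_df_left)
      qed (use typR in simp)
      finally show ?thesis .
    qed (simp add: L1_zero R1_zero)
    \<comment> \<open>Directions of the second factor. The differentials carry the sign \<open>(-1)\<^bsup>ht pb\<^esup>\<close> on the left
      and \<open>(-1)\<^bsup>ht pa\<^esup>\<close> on the right; both sides vanish unless these heights agree.\<close>
    have part2: "?\<Sigma> (\<lambda>j. entry ?\<gamma> a (b + \<epsilon> (?n + j)) \<cdot> df ?S b (?n + j)) {..<?m}
      = ?\<Sigma> (\<lambda>j. df ?S' (a - \<epsilon> (?n' + j)) (?n' + j) \<cdot> entry ?\<gamma> (a - \<epsilon> (?n' + j)) b) {..<?m'}"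
    proof (cases "ht pa = ht pb")
      case True
      then have hs: "ht sa = ht sb + 1" using ht ab by linarith
      have eL: "entry \<beta> sa (sb + \<epsilon> i) \<in> Hom A (ob ?Q (sb + \<epsilon> i)) (ob ?Q' sa)" for i
        by (rule e) (simp add: hs ht_add)
      have eR: "entry \<beta> (sa - \<epsilon> i) sb \<in> Hom A (ob ?Q sb) (ob ?Q' (sa - \<epsilon> i))" for i
        by (rule e) (simp add: hs ht_diff_unit)
      have dR: "df ?Q' (sa - \<epsilon> i) i \<in> Hom A (ob ?Q' (sa - \<epsilon> i)) (ob ?Q' sa)" for i
        using df(4)[of "sa - \<epsilon> i" i] by simp
      note ep = e(1)[OF True]
      have tL: "entry \<alpha> pa pb \<odot>\<^sub>0\<^bsub>T\<^esub> (entry \<beta> sa (sb + \<epsilon> j) \<cdot> df ?Q sb j) \<in> Hom A (ob ?S b) (ob ?S' a)" for j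
        using TensA_in_Hom[OF ep Comp_in_Hom[OF df(3) eL]] by (simp add: S_b S'_a)
      have tR: "entry \<alpha> pa pb \<odot>\<^sub>0\<^bsub>T\<^esub> (df ?Q' (sa - \<epsilon> j) j \<cdot> entry \<beta> (sa - \<epsilon> j) sb)
          \<in> Hom A (ob ?S b) (ob ?S' a)" for j
        using TensA_in_Hom[OF ep Comp_in_Hom[OF eR dR]] by (simp add: S_b S'_a)
      have "?\<Sigma> (\<lambda>j. entry ?\<gamma> a (b + \<epsilon> (?n + j)) \<cdot> df ?S b (?n + j)) {..<?m}
        = ?\<Sigma> (\<lambda>j. signed A (ht pb) (entry \<alpha> pa pb \<odot>\<^sub>0\<^bsub>T\<^esub> (entry \<beta> sa (sb + \<epsilon> j) \<cdot> df ?Q sb j))) {..<?m}"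
      proof (rule sum_cong[OF obj(5,6)])
        fix j
        show "entry ?\<gamma> a (b + \<epsilon> (?n + j)) \<cdot> df ?S b (?n + j)
          = signed A (ht pb) (entry \<alpha> pa pb \<odot>\<^sub>0\<^bsub>T\<^esub> (entry \<beta> sa (sb + \<epsilon> j) \<cdot> df ?Q sb j))"
          using ab True TensA_Comp[OF I(1) ep df(3) eL] Comp_Ident_right[OF ep]
            Comp_signed_right[OF TensA_in_Hom[OF ep eL] TensA_in_Hom[OF I(1) df(3)]]
          by (simp add: entry_tensA ht_add unit_split_simps defs tensO_df_right)
      qed (use tL signed_in_Hom in simp)
      also have "\<dots> = signed A (ht pb) (?\<Sigma> (\<lambda>j. entry \<alpha> pa pb \<odot>\<^sub>0\<^bsub>T\<^esub> (entry \<beta> sa (sb + \<epsilon> j) \<cdot> df ?Q sb j)) {..<?m})"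
        by (rule signed_sum[OF obj(5,6)]) (use tL in simp)
      also have "?\<Sigma> (\<lambda>j. entry \<alpha> pa pb \<odot>\<^sub>0\<^bsub>T\<^esub> (entry \<beta> sa (sb + \<epsilon> j) \<cdot> df ?Q sb j)) {..<?m}
        = entry \<alpha> pa pb \<odot>\<^sub>0\<^bsub>T\<^esub> finprod (Hom_group A (ob ?Q sb) (ob ?Q' sa))
          (\<lambda>j. entry \<beta> sa (sb + \<epsilon> j) \<cdot> df ?Q sb j) {..<?m}"
        unfolding S_b S'_a using Comp_in_Hom[OF df(3) eL]
        by (intro TensA_sum_right[symmetric, OF ep obj(3,4)]) simp
      also have "\<dots> = entry \<alpha> pa pb \<odot>\<^sub>0\<^bsub>T\<^esub> finprod (Hom_group A (ob ?Q sb) (ob ?Q' sa))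
          (\<lambda>j. df ?Q' (sa - \<epsilon> j) j \<cdot> entry \<beta> (sa - \<epsilon> j) sb) {..<?m'}"
        using \<beta> hs by (simp add: is_pyramid_mor_entry)
      also have "\<dots> = ?\<Sigma> (\<lambda>j. entry \<alpha> pa pb \<odot>\<^sub>0\<^bsub>T\<^esub> (df ?Q' (sa - \<epsilon> j) j \<cdot> entry \<beta> (sa - \<epsilon> j) sb)) {..<?m'}"
        unfolding S_b S'_a using Comp_in_Hom[OF eR dR] by (intro TensA_sum_right[OF ep obj(3,4)]) simp
      also have "signed A (ht pb) \<dots>
        = ?\<Sigma> (\<lambda>j. signed A (ht pb)
            (entry \<alpha> pa pb \<odot>\<^sub>0\<^bsub>T\<^esub> (df ?Q' (sa - \<epsilon> j) j \<cdot> entry \<beta> (sa - \<epsilon> j) sb))) {..<?m'}"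
        by (rule signed_sum[OF obj(5,6), symmetric]) (use tR in simp)
      also have "\<dots> = ?\<Sigma> (\<lambda>j. df ?S' (a - \<epsilon> (?n' + j)) (?n' + j) \<cdot> entry ?\<gamma> (a - \<epsilon> (?n' + j)) b) {..<?m'}"
      proof (rule sum_cong[OF obj(5,6)])
        fix j
        show "signed A (ht pb) (entry \<alpha> pa pb \<odot>\<^sub>0\<^bsub>T\<^esub> (df ?Q' (sa - \<epsilon> j) j \<cdot> entry \<beta> (sa - \<epsilon> j) sb))
          = df ?S' (a - \<epsilon> (?n' + j)) (?n' + j) \<cdot> entry ?\<gamma> (a - \<epsilon> (?n' + j)) b"
          using ab True TensA_Comp[OF ep I(2) eR dR] Comp_Ident_left[OF ep]
            Comp_signed_left[OF TensA_in_Hom[OF I(2) dR] TensA_in_Hom[OF ep eR]]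
          by (simp add: entry_tensA ht_diff_unit unit_split_simps defs tensO_df_right)
      qed (use typR in simp)
      finally show ?thesis .
    qed (simp add: L2_zero R2_zero)
    show ?thesis unfolding L R part1 part2 ..
  qed
  then show ?thesis
    using S S' tensA_Mat[OF \<alpha> \<beta>] by (simp add: is_pyramid_mor_entry)
qed

end

section \<open>Associativity and units\<close>

lemma pyramid_unit_simps:
  "ob (pyramid_unit A T) a = (if a = 0 then Unit T else zero_obj A)"
  "len (pyramid_unit A T) = 0"
  by (simp_all add: pyramid_unit_def Let_def)

lemma Hom_Arr: "f \<in> Hom C X Y \<Longrightarrow> f \<in> Arr C"
  by (simp add: Hom_def)

context additive_monoidal_category
begin

lemma TensA_signed_left:
  "f \<in> Hom A X X' \<Longrightarrow> g \<in> Hom A Y Y' \<Longrightarrow> signed A s f \<odot>\<^sub>0\<^bsub>T\<^esub> g = signed A s (f \<odot>\<^sub>0\<^bsub>T\<^esub> g)"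
  by (simp add: signed_def TensA_Neg_left)

lemma TensA_signed_right:
  "f \<in> Hom A X X' \<Longrightarrow> g \<in> Hom A Y Y' \<Longrightarrow> f \<odot>\<^sub>0\<^bsub>T\<^esub> signed A s g = signed A s (f \<odot>\<^sub>0\<^bsub>T\<^esub> g)"
  by (simp add: signed_def TensA_Neg_right)

lemma tensO_assoc:
  assumes P: "is_pyramid A P" and Q: "is_pyramid A Q" and R: "is_pyramid A R"
  shows "pyramid_tensO A T (pyramid_tensO A T P Q) R = pyramid_tensO A T P (pyramid_tensO A T Q R)"
proof (rule pyramid.equality)
  let ?n = "len P" and ?m = "len Q"
  let ?PQ = "pyramid_tensO A T P Q" and ?QR = "pyramid_tensO A T Q R"
  let ?L = "pyramid_tensO A T ?PQ R" and ?R = "pyramid_tensO A T P ?QR"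
  note obj = pyramid_ob_in_Obj[OF P] pyramid_ob_in_Obj[OF Q] pyramid_ob_in_Obj[OF R]
  note df = pyramid_df_in_Hom[OF P] pyramid_df_in_Hom[OF Q] pyramid_df_in_Hom[OF R]
  note I = obj[THEN Ident_in_Hom]
  note split = trunc_trunc shift_trunc shift_shift
  show "ob ?L = ob ?R"
    by (rule ext) (simp add: tensO_ob tensO_len split TensO_assoc obj)
  show "len ?L = len ?R" by (simp add: tensO_len)
  show "df ?L = df ?R"
  proof (intro ext)
    fix a i
    consider "i < ?n" | j where "i = ?n + j" "j < ?m" | j where "i = ?n + (?m + j)"
      by (metis less_or_add_cases)
    then show "df ?L a i = df ?R a i"
    proof cases
      case 1
      then show ?thesis
        by (simp add: tensO_df_left tensO_len tensO_ob split TensA_Ident[symmetric] obj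
            TensA_assoc df[THEN Hom_Arr] I[THEN Hom_Arr])
    next
      case (2 j)
      then have "df ?L a i = signed A (ht (\<pi> ?n a))
          ((Ident A (ob P (\<pi> ?n a)) \<odot>\<^sub>0\<^bsub>T\<^esub> df Q (\<pi> ?m (\<sigma> ?n a)) j) \<odot>\<^sub>0\<^bsub>T\<^esub> Ident A (ob R (\<sigma> (?n + ?m) a)))"
        by (simp add: tensO_df_left tensO_df_right tensO_len tensO_ob split
            TensA_signed_left[OF TensA_in_Hom[OF I(1) df(2)] I(3)])
      moreover have "df ?R a i = signed A (ht (\<pi> ?n a))
          (Ident A (ob P (\<pi> ?n a)) \<odot>\<^sub>0\<^bsub>T\<^esub> (df Q (\<pi> ?m (\<sigma> ?n a)) j \<odot>\<^sub>0\<^bsub>T\<^esub> Ident A (ob R (\<sigma> (?n + ?m) a))))"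
        using 2 by (simp add: tensO_df_left tensO_df_right split)
      ultimately show ?thesis by (simp add: TensA_assoc df[THEN Hom_Arr] I[THEN Hom_Arr])
    next
      case (3 j)
      have i: "i = len ?PQ + j" using 3 by (simp add: tensO_len)
      have ht: "ht (\<pi> (?n + ?m) a) = ht (\<pi> ?n a) + ht (\<pi> ?m (\<sigma> ?n a))"
        using ht_trunc_shift[of ?n "\<pi> (?n + ?m) a"] by (simp add: split)
      have "df ?L a i = signed A (ht (\<pi> ?n a) + ht (\<pi> ?m (\<sigma> ?n a)))
          ((Ident A (ob P (\<pi> ?n a)) \<odot>\<^sub>0\<^bsub>T\<^esub> Ident A (ob Q (\<pi> ?m (\<sigma> ?n a)))) \<odot>\<^sub>0\<^bsub>T\<^esub> df R (\<sigma> (?n + ?m) a) j)"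
        unfolding i tensO_df_right by (simp add: tensO_len tensO_ob split ht TensA_Ident obj)
      moreover have "df ?R a i = signed A (ht (\<pi> ?n a) + ht (\<pi> ?m (\<sigma> ?n a)))
          (Ident A (ob P (\<pi> ?n a)) \<odot>\<^sub>0\<^bsub>T\<^esub> (Ident A (ob Q (\<pi> ?m (\<sigma> ?n a))) \<odot>\<^sub>0\<^bsub>T\<^esub> df R (\<sigma> (?n + ?m) a) j))"
        unfolding 3 tensO_df_right
        by (simp add: split TensA_signed_right[OF I(1) TensA_in_Hom[OF I(2) df(3)]]
            signed_signed[OF TensA_in_Hom[OF I(1) TensA_in_Hom[OF I(2) df(3)]]])
      ultimately show ?thesis by (simp add: TensA_assoc df[THEN Hom_Arr] I[THEN Hom_Arr])
    qed
  qed
qed simp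

lemma tensA_assoc:
  assumes \<alpha>: "is_pyramid_mor A \<alpha>" and \<beta>: "is_pyramid_mor A \<beta>" and \<gamma>: "is_pyramid_mor A \<gamma>"
  shows "pyramid_tensA A T (pyramid_tensA A T \<alpha> \<beta>) \<gamma> = pyramid_tensA A T \<alpha> (pyramid_tensA A T \<beta> \<gamma>)"
proof (rule pyramid_mor_eqI)
  let ?n = "len (src \<alpha>)" and ?n' = "len (tgt \<alpha>)" and ?m = "len (src \<beta>)" and ?m' = "len (tgt \<beta>)"
  let ?\<alpha>\<beta> = "pyramid_tensA A T \<alpha> \<beta>" and ?\<beta>\<gamma> = "pyramid_tensA A T \<beta> \<gamma>"
  let ?L = "pyramid_tensA A T ?\<alpha>\<beta> \<gamma>" and ?R = "pyramid_tensA A T \<alpha> ?\<beta>\<gamma>"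
  note pyr = pyramid_mor_src_tgt[OF \<alpha>] pyramid_mor_src_tgt[OF \<beta>] pyramid_mor_src_tgt[OF \<gamma>]
  show "is_pyramid_mor A ?L" "is_pyramid_mor A ?R"
    by (rule tensA_mor tensA_mor \<alpha> \<beta> \<gamma>)+
  show src: "src ?L = src ?R" and tgt: "tgt ?L = tgt ?R"
    using pyr by (simp_all add: tensO_assoc)
  note obj = pyr[THEN pyramid_ob_in_Obj]
  note split = trunc_trunc shift_trunc shift_shift
  fix a b assume ab: "ht a = ht b"
  define a1 a2 a3 where "a1 = \<pi> ?n' a" and "a2 = \<pi> ?m' (\<sigma> ?n' a)" and "a3 = \<sigma> (?n' + ?m') a"
  define b1 b2 b3 where "b1 = \<pi> ?n b" and "b2 = \<pi> ?m (\<sigma> ?n b)" and "b3 = \<sigma> (?n + ?m) b"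
  note defs = a1_def[symmetric] a2_def[symmetric] a3_def[symmetric]
    b1_def[symmetric] b2_def[symmetric] b3_def[symmetric]
  have hta: "ht (\<pi> (?n' + ?m') a) = ht a1 + ht a2" "ht (\<sigma> ?n' a) = ht a2 + ht a3"
    "ht a = ht a1 + ht (\<sigma> ?n' a)"
    using ht_trunc_shift[of ?n' "\<pi> (?n' + ?m') a"] ht_trunc_shift[of ?m' "\<sigma> ?n' a"] ht_trunc_shift[of ?n' a]
    by (simp_all add: split defs)
  have htb: "ht (\<pi> (?n + ?m) b) = ht b1 + ht b2" "ht (\<sigma> ?n b) = ht b2 + ht b3"
    "ht b = ht b1 + ht (\<sigma> ?n b)"
    using ht_trunc_shift[of ?n "\<pi> (?n + ?m) b"] ht_trunc_shift[of ?m "\<sigma> ?n b"] ht_trunc_shift[of ?n b]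
    by (simp_all add: split defs)
  let ?Z = "Zero A (ob (src ?R) b) (ob (tgt ?R) a)"
  let ?ok = "ht a1 = ht b1 \<and> ht a2 = ht b2"
  have ZL: "Zero A (ob (pyramid_tensO A T (src ?\<alpha>\<beta>) (src \<gamma>)) b) (ob (pyramid_tensO A T (tgt ?\<alpha>\<beta>) (tgt \<gamma>)) a) = ?Z"
    using src tgt by simp
  have L: "entry ?L a b = (if ?ok then (entry \<alpha> a1 b1 \<odot>\<^sub>0\<^bsub>T\<^esub> entry \<beta> a2 b2) \<odot>\<^sub>0\<^bsub>T\<^esub> entry \<gamma> a3 b3 else ?Z)"
  proof (cases "ht a1 + ht a2 = ht b1 + ht b2")
    case True
    then have h3: "ht a3 = ht b3" using hta htb ab by linarith
    have "entry ?L a b = entry ?\<alpha>\<beta> (\<pi> (?n' + ?m') a) (\<pi> (?n + ?m) b) \<odot>\<^sub>0\<^bsub>T\<^esub> entry \<gamma> a3 b3"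
      unfolding entry_tensA[OF ab] by (simp add: tensO_len hta htb True defs)
    also have "entry ?\<alpha>\<beta> (\<pi> (?n' + ?m') a) (\<pi> (?n + ?m) b) =
      (if ht a1 = ht b1 then entry \<alpha> a1 b1 \<odot>\<^sub>0\<^bsub>T\<^esub> entry \<beta> a2 b2
       else Zero A (ob (src ?\<alpha>\<beta>) (\<pi> (?n + ?m) b)) (ob (tgt ?\<alpha>\<beta>) (\<pi> (?n' + ?m') a)))"
      using True by (subst entry_tensA) (simp_all add: hta htb split defs)
    finally show ?thesis
      using True TensA_Zero_left[OF entry_in_Hom[OF \<gamma> h3]] TensO_in_Obj obj ZL[symmetric]
      by (auto simp: tensO_ob tensO_len split defs)
  next
    case False
    then show ?thesis unfolding entry_tensA[OF ab] ZL by (auto simp: tensO_len hta htb)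
  qed
  have R: "entry ?R a b = (if ?ok then entry \<alpha> a1 b1 \<odot>\<^sub>0\<^bsub>T\<^esub> (entry \<beta> a2 b2 \<odot>\<^sub>0\<^bsub>T\<^esub> entry \<gamma> a3 b3) else ?Z)"
  proof (cases "ht a1 = ht b1")
    case True
    then have h: "ht (\<sigma> ?n' a) = ht (\<sigma> ?n b)" using hta htb ab by linarith
    have "entry ?R a b = entry \<alpha> a1 b1 \<odot>\<^sub>0\<^bsub>T\<^esub> entry ?\<beta>\<gamma> (\<sigma> ?n' a) (\<sigma> ?n b)"
      unfolding entry_tensA[OF ab] by (simp add: True defs)
    also have "entry ?\<beta>\<gamma> (\<sigma> ?n' a) (\<sigma> ?n b) =
      (if ht a2 = ht b2 then entry \<beta> a2 b2 \<odot>\<^sub>0\<^bsub>T\<^esub> entry \<gamma> a3 b3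
       else Zero A (ob (src ?\<beta>\<gamma>) (\<sigma> ?n b)) (ob (tgt ?\<beta>\<gamma>) (\<sigma> ?n' a)))"
      unfolding entry_tensA[OF h] by (simp add: split defs)
    finally show ?thesis
      using True TensA_Zero_right[OF entry_in_Hom[OF \<alpha> True]] TensO_in_Obj obj
      by (auto simp: tensO_ob split defs)
  next
    case False
    then show ?thesis unfolding entry_tensA[OF ab] by (auto simp: defs)
  qed
  have "(entry \<alpha> a1 b1 \<odot>\<^sub>0\<^bsub>T\<^esub> entry \<beta> a2 b2) \<odot>\<^sub>0\<^bsub>T\<^esub> entry \<gamma> a3 b3
    = entry \<alpha> a1 b1 \<odot>\<^sub>0\<^bsub>T\<^esub> (entry \<beta> a2 b2 \<odot>\<^sub>0\<^bsub>T\<^esub> entry \<gamma> a3 b3)" if ?ok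
    using that hta htb ab
    by (intro TensA_assoc Hom_Arr[OF entry_in_Hom[OF \<alpha>]] Hom_Arr[OF entry_in_Hom[OF \<beta>]]
        Hom_Arr[OF entry_in_Hom[OF \<gamma>]]) auto
  then show "entry ?L a b = entry ?R a b" unfolding L R by simp
qed

lemma tensO_unit_left:
  assumes P: "is_pyramid A P"
  shows "pyramid_tensO A T (pyramid_unit A T) P = P"
proof (rule pyramid.equality)
  let ?L = "pyramid_tensO A T (pyramid_unit A T) P"
  show "ob ?L = ob P"
    using pyramid_ob_in_Obj[OF P] by (auto simp: tensO_ob pyramid_unit_simps Unit_left)
  show "df ?L = df P"
  proof (intro ext)
    fix a i
    show "df ?L a i = df P a i"
      using tensO_df_right[of A T "pyramid_unit A T" P a i]
        Ident_Unit_left[OF Hom_Arr[OF pyramid_df_in_Hom[OF P]]]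
      by (simp add: pyramid_unit_simps signed_def)
  qed
  show "len ?L = len P" by (simp add: tensO_len pyramid_unit_simps)
qed simp

lemma tensO_unit_right:
  assumes P: "is_pyramid A P"
  shows "pyramid_tensO A T P (pyramid_unit A T) = P"
proof (rule pyramid.equality)
  let ?L = "pyramid_tensO A T P (pyramid_unit A T)" and ?n = "len P"
  note obj = pyramid_ob_in_Obj[OF P]
  have nz: "\<pi> ?n a = a" "\<sigma> ?n a = 0" if "ob P a \<noteq> zero_obj A" for a
    using pyramid_nonzero_trunc[OF P that] pyramid_nonzero_shift[OF P that] by auto
  show ob: "ob ?L = ob P"
  proof
    fix a
    show "ob ?L a = ob P a"
    proof (cases "\<sigma> ?n a = 0")
      case True
      then have "\<pi> ?n a = a"
        using trunc_shift_eq_iff[of ?n "\<pi> ?n a" a] trunc_trunc[of ?n 0 a] shift_trunc[of ?n 0 a] by simp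
      then show ?thesis using True Unit_right[OF obj] by (simp add: tensO_ob pyramid_unit_simps)
    next
      case False
      then have "ob P a = zero_obj A" using nz by blast
      then show ?thesis using False TensO_zero_obj_right[OF obj] by (simp add: tensO_ob pyramid_unit_simps)
    qed
  qed
  show "df ?L = df P"
  proof (intro ext)
    fix a i
    \<comment> \<open>Both sides are arrows between the same objects, so they agree unless source and target
      are nonzero; the latter forces \<open>i < len P\<close>.\<close>
    note dL = pyramid_df_in_Hom[OF tensO_pyramid[OF P unit_pyramid], of a i, unfolded ob]
    show "df ?L a i = df P a i"
    proof (cases "ob P a = zero_obj A \<or> ob P (a + \<epsilon> i) = zero_obj A")
      case True
      then show ?thesis by (rule Hom_zero_obj_unique[OF dL pyramid_df_in_Hom[OF P]])
    next
      case False
      then have "\<sigma> ?n (\<epsilon> i) = 0" using nz(2)[of a] nz(2)[of "a + \<epsilon> i"] by (simp add: shift_add)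
      then have "i < ?n" by (simp add: shift_unit split: if_splits)
      then show ?thesis
        using False nz[of a] Ident_Unit_right[OF Hom_Arr[OF pyramid_df_in_Hom[OF P]]]
        by (simp add: tensO_df_left pyramid_unit_simps)
    qed
  qed
  show "len ?L = len P" by (simp add: tensO_len pyramid_unit_simps)
qed simp

lemma tensA_unit_left:
  assumes \<alpha>: "is_pyramid_mor A \<alpha>"
  shows "pyramid_tensA A T (pyramid_ident A (pyramid_unit A T)) \<alpha> = \<alpha>"
proof (rule pyramid_mor_eqI[OF tensA_mor[OF pyramid_mor_ident[OF unit_pyramid] \<alpha>] \<alpha>])
  note P = pyramid_mor_src_tgt[OF \<alpha>]
  fix a b assume ab: "ht a = ht b"
  show "entry (pyramid_tensA A T (pyramid_ident A (pyramid_unit A T)) \<alpha>) a b = entry \<alpha> a b"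
    using Ident_Unit_left[OF Hom_Arr[OF entry_in_Hom[OF \<alpha> ab]]]
    by (simp add: entry_tensA[OF ab] entry_ident pyramid_unit_simps)
qed (use pyramid_mor_src_tgt[OF \<alpha>] in \<open>simp_all add: tensO_unit_left\<close>)

lemma tensA_unit_right:
  assumes \<alpha>: "is_pyramid_mor A \<alpha>"
  shows "pyramid_tensA A T \<alpha> (pyramid_ident A (pyramid_unit A T)) = \<alpha>"
proof (rule pyramid_mor_eqI[OF _ \<alpha>])
  let ?U = "pyramid_ident A (pyramid_unit A T)"
  note P = pyramid_mor_src_tgt[OF \<alpha>]
  show mor: "is_pyramid_mor A (pyramid_tensA A T \<alpha> ?U)"
    by (rule tensA_mor[OF \<alpha> pyramid_mor_ident[OF unit_pyramid]])
  show src: "src (pyramid_tensA A T \<alpha> ?U) = src \<alpha>" and tgt: "tgt (pyramid_tensA A T \<alpha> ?U) = tgt \<alpha>"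
    using P by (simp_all add: tensO_unit_right)
  fix a b assume ab: "ht a = ht b"
  show "entry (pyramid_tensA A T \<alpha> ?U) a b = entry \<alpha> a b"
  proof (cases "ob (src \<alpha>) b = zero_obj A \<or> ob (tgt \<alpha>) a = zero_obj A")
    case True
    then show ?thesis
      by (rule Hom_zero_obj_unique[OF entry_in_Hom[OF mor ab, unfolded src tgt] entry_in_Hom[OF \<alpha> ab]])
  next
    case False
    then show ?thesis
      using pyramid_nonzero_trunc[OF P(1), of b] pyramid_nonzero_shift[OF P(1), of b]
        pyramid_nonzero_trunc[OF P(2), of a] pyramid_nonzero_shift[OF P(2), of a]
        Ident_Unit_right[OF Hom_Arr[OF entry_in_Hom[OF \<alpha> ab]]] ab
      by (simp add: entry_tensA[OF ab] entry_ident pyramid_unit_simps)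
  qed
qed

section \<open>Functoriality of the tensor product\<close>

lemma tensA_ident:
  assumes P: "is_pyramid A P" and Q: "is_pyramid A Q"
  shows "pyramid_tensA A T (pyramid_ident A P) (pyramid_ident A Q) = pyramid_ident A (pyramid_tensO A T P Q)"
proof (rule pyramid_mor_eqI)
  let ?L = "pyramid_tensA A T (pyramid_ident A P) (pyramid_ident A Q)"
  note obj = pyramid_ob_in_Obj[OF P] pyramid_ob_in_Obj[OF Q]
  note I = obj[THEN Ident_in_Hom]
  show "is_pyramid_mor A ?L" "is_pyramid_mor A (pyramid_ident A (pyramid_tensO A T P Q))"
    using P Q by (auto intro: tensA_mor pyramid_mor_ident tensO_pyramid)
  fix a b assume ab: "ht a = ht b"
  define pa sa where "pa = \<pi> (len P) a" and "sa = \<sigma> (len P) a"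
  define pb sb where "pb = \<pi> (len P) b" and "sb = \<sigma> (len P) b"
  note defs = pa_def[symmetric] sa_def[symmetric] pb_def[symmetric] sb_def[symmetric]
  have ht: "ht pa + ht sa = ht a" "ht pb + ht sb = ht b"
    unfolding pa_def sa_def pb_def sb_def by (rule ht_trunc_shift)+
  have eq: "a = b \<longleftrightarrow> pa = pb \<and> sa = sb"
    unfolding pa_def sa_def pb_def sb_def by (rule trunc_shift_eq_iff[symmetric])
  show "entry ?L a b = entry (pyramid_ident A (pyramid_tensO A T P Q)) a b"
  proof (cases "ht pa = ht pb")
    case True
    then have hs: "ht sa = ht sb" using ht ab by linarith
    consider "pa \<noteq> pb" | "pa = pb" "sa \<noteq> sb" | "pa = pb" "sa = sb" by blast
    then show ?thesis
    proof cases
      case 1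
      then show ?thesis
        using True hs eq TensA_Zero_left[OF entry_in_Hom[OF pyramid_mor_ident[OF Q] hs] obj(1) obj(1)]
        by (simp add: entry_tensA[OF ab] entry_ident ab defs tensO_ob)
    next
      case 2
      then show ?thesis
        using hs eq TensA_Zero_right[OF I(1) obj(2) obj(2)]
        by (simp add: entry_tensA[OF ab] entry_ident ab defs tensO_ob)
    next
      case 3
      then show ?thesis
        using eq TensA_Ident[OF obj] by (simp add: entry_tensA entry_ident defs tensO_ob)
    qed
  next
    case False
    then show ?thesis using eq by (auto simp: entry_tensA[OF ab] entry_ident ab defs)
  qed
qed simp_all

text \<open>The middle indices may be restricted to those with a nonzero object.\<close>

lemma entry_comp_support:
  assumes \<alpha>: "is_pyramid_mor A \<alpha>" and \<beta>: "is_pyramid_mor A \<beta>" and eq: "tgt \<alpha> = src \<beta>"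
    and ab: "ht a = ht b"
  shows "entry (pyramid_comp A \<beta> \<alpha>) a b
    = finprod (Hom_group A (ob (src \<alpha>) b) (ob (tgt \<beta>) a)) (\<lambda>c. entry \<beta> a c \<cdot> entry \<alpha> c b)
        {c \<in> level (ht b). ob (tgt \<alpha>) c \<noteq> zero_obj A}"
proof (rule entry_comp[OF \<alpha> \<beta> eq ab])
  note P = pyramid_mor_src_tgt[OF \<alpha>]
  show "finite {c \<in> level (ht b). ob (tgt \<alpha>) c \<noteq> zero_obj A}"
    using finite_level_support[OF P(2)] .
  fix c assume c: "c \<in> level (ht b) - {c \<in> level (ht b). ob (tgt \<alpha>) c \<noteq> zero_obj A}"
  then have h: "ht c = ht b" by (simp add: level_def)
  have "entry \<alpha> c b = Zero A (ob (src \<alpha>) b) (ob (tgt \<alpha>) c)"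
    by (rule Hom_zero_obj_unique[OF entry_in_Hom[OF \<alpha> h] Zero_in_Hom])
      (use c P[THEN pyramid_ob_in_Obj] zero_obj_in_Obj in auto)
  then show "entry \<beta> a c \<cdot> entry \<alpha> c b = Zero A (ob (src \<alpha>) b) (ob (tgt \<beta>) a)"
    using Comp_Zero_right[OF entry_in_Hom[OF \<beta>, of a c]] h ab eq P[THEN pyramid_ob_in_Obj] by simp
qed auto

lemma tensA_comp:
  assumes \<alpha>: "is_pyramid_mor A \<alpha>" and \<alpha>': "is_pyramid_mor A \<alpha>'" and eq\<alpha>: "tgt \<alpha> = src \<alpha>'"
    and \<beta>: "is_pyramid_mor A \<beta>" and \<beta>': "is_pyramid_mor A \<beta>'" and eq\<beta>: "tgt \<beta> = src \<beta>'"
  shows "pyramid_tensA A T (pyramid_comp A \<alpha>' \<alpha>) (pyramid_comp A \<beta>' \<beta>)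
    = pyramid_comp A (pyramid_tensA A T \<alpha>' \<beta>') (pyramid_tensA A T \<alpha> \<beta>)"
proof (rule pyramid_mor_eqI)
  let ?\<gamma> = "pyramid_tensA A T \<alpha> \<beta>" and ?\<gamma>' = "pyramid_tensA A T \<alpha>' \<beta>'"
  let ?L = "pyramid_tensA A T (pyramid_comp A \<alpha>' \<alpha>) (pyramid_comp A \<beta>' \<beta>)" and ?R = "pyramid_comp A ?\<gamma>' ?\<gamma>"
  let ?n = "len (src \<alpha>)" and ?n' = "len (tgt \<alpha>)" and ?n'' = "len (tgt \<alpha>')"
  have \<gamma>: "is_pyramid_mor A ?\<gamma>" "is_pyramid_mor A ?\<gamma>'" "tgt ?\<gamma> = src ?\<gamma>'"
    using \<alpha> \<alpha>' \<beta> \<beta>' eq\<alpha> eq\<beta> by (auto intro: tensA_mor)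
  show "is_pyramid_mor A ?L" "is_pyramid_mor A ?R"
    using \<alpha> \<alpha>' \<beta> \<beta>' eq\<alpha> eq\<beta> \<gamma> by (auto intro!: tensA_mor pyramid_mor_comp)
  note P = pyramid_mor_src_tgt(1)[OF \<alpha>] pyramid_mor_src_tgt(2)[OF \<alpha>] pyramid_mor_src_tgt(2)[OF \<alpha>']
  note Q = pyramid_mor_src_tgt(1)[OF \<beta>] pyramid_mor_src_tgt(2)[OF \<beta>] pyramid_mor_src_tgt(2)[OF \<beta>']
  note obj = P[THEN pyramid_ob_in_Obj] Q[THEN pyramid_ob_in_Obj]
  fix a b assume ab: "ht a = ht b"
  define pa sa where "pa = \<pi> ?n'' a" and "sa = \<sigma> ?n'' a"
  define pb sb where "pb = \<pi> ?n b" and "sb = \<sigma> ?n b"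
  note defs = pa_def[symmetric] sa_def[symmetric] pb_def[symmetric] sb_def[symmetric]
  have ht: "ht pa + ht sa = ht a" "ht pb + ht sb = ht b"
    unfolding pa_def sa_def pb_def sb_def by (rule ht_trunc_shift)+
  let ?X = "ob (src ?\<gamma>) b" and ?Y = "ob (tgt ?\<gamma>') a"
  let ?\<Sigma> = "finprod (Hom_group A ?X ?Y)"
  have X: "?X = ob (src \<alpha>) pb \<odot>\<^bsub>T\<^esub> ob (src \<beta>) sb" and Y: "?Y = ob (tgt \<alpha>') pa \<odot>\<^bsub>T\<^esub> ob (tgt \<beta>') sa"
    by (simp_all add: tensO_ob defs)
  have XY: "?X \<in> Obj A" "?Y \<in> Obj A" unfolding X Y using TensO_in_Obj obj by auto
  have hc: "ht (\<pi> ?n' c) + ht (\<sigma> ?n' c) = ht c" for c by (rule ht_trunc_shift)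
  have vanish: "entry ?\<gamma>' a c \<cdot> entry ?\<gamma> c b = Zero A ?X ?Y"
    if "ht c = ht b" "ht (\<pi> ?n' c) \<noteq> ht pa \<or> ht (\<pi> ?n' c) \<noteq> ht pb" for c
  proof -
    have "entry ?\<gamma>' a c = Zero A (ob (tgt ?\<gamma>) c) ?Y \<or> entry ?\<gamma> c b = Zero A ?X (ob (tgt ?\<gamma>) c)"
      using that ab by (auto simp: entry_tensA defs eq\<alpha>[symmetric] eq\<beta>[symmetric])
    then show ?thesis
      using Comp_Zero_left[OF entry_in_Hom[OF \<gamma>(1) that(1)] XY(2)]
        Comp_Zero_right[OF entry_in_Hom[OF \<gamma>(2), of a c] XY(1)] that(1) ab \<gamma>(3) by auto
  qed
  show "entry ?L a b = entry ?R a b"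
  proof (cases "ht pa = ht pb")
    case False
    \<comment> \<open>No middle index has a first part of the height of both \<open>pa\<close> and \<open>pb\<close>.\<close>
    have "entry ?R a b = ?\<Sigma> (\<lambda>c. entry ?\<gamma>' a c \<cdot> entry ?\<gamma> c b) {}"
      by (rule entry_comp[OF \<gamma> ab]) (use vanish False in \<open>auto simp: level_def\<close>)
    then show ?thesis using False XY by (simp add: entry_tensA[OF ab] defs sum_empty)
  next
    case True
    then have hs: "ht sa = ht sb" using ht ab by linarith
    let ?S = "{p \<in> level (ht pb). ob (tgt \<alpha>) p \<noteq> zero_obj A}"
    let ?Q = "{q \<in> level (ht sb). ob (tgt \<beta>) q \<noteq> zero_obj A}"
    \<comment> \<open>The nonzero terms belong to indices that are joined from the supports of the two middle
      pyramids at the levels determined by \<open>b\<close>.\<close>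
    let ?F = "(\<lambda>(p, q). join ?n' p q) ` (?S \<times> ?Q)"
    let ?f = "\<lambda>p. entry \<alpha>' pa p \<cdot> entry \<alpha> p pb" and ?g = "\<lambda>q. entry \<beta>' sa q \<cdot> entry \<beta> q sb"
    have fin: "finite ?S" "finite ?Q" using finite_level_support P(2) Q(2) by blast+
    have e: "entry \<alpha> p pb \<in> Hom A (ob (src \<alpha>) pb) (ob (tgt \<alpha>) p)"
      "entry \<alpha>' pa p \<in> Hom A (ob (tgt \<alpha>) p) (ob (tgt \<alpha>') pa)" if "p \<in> ?S" for p
      using that entry_in_Hom[OF \<alpha>, of p pb] entry_in_Hom[OF \<alpha>', of pa p] True eq\<alpha> by (auto simp: level_def)
    have e': "entry \<beta> q sb \<in> Hom A (ob (src \<beta>) sb) (ob (tgt \<beta>) q)"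
      "entry \<beta>' sa q \<in> Hom A (ob (tgt \<beta>) q) (ob (tgt \<beta>') sa)" if "q \<in> ?Q" for q
      using that entry_in_Hom[OF \<beta>, of q sb] entry_in_Hom[OF \<beta>', of sa q] hs eq\<beta> by (auto simp: level_def)
    have f: "?f p \<in> Hom A (ob (src \<alpha>) pb) (ob (tgt \<alpha>') pa)" if "p \<in> ?S" for p
      using Comp_in_Hom[OF e[OF that]] .
    have g: "?g q \<in> Hom A (ob (src \<beta>) sb) (ob (tgt \<beta>') sa)" if "q \<in> ?Q" for q
      using Comp_in_Hom[OF e'[OF that]] .
    have fg: "?f p \<odot>\<^sub>0\<^bsub>T\<^esub> ?g q \<in> Hom A ?X ?Y" if "p \<in> ?S" "q \<in> ?Q" for p q
      unfolding X Y by (rule TensA_in_Hom[OF f g]) fact+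
    have sum_g: "finprod (Hom_group A (ob (src \<beta>) sb) (ob (tgt \<beta>') sa)) ?g ?Q
        \<in> Hom A (ob (src \<beta>) sb) (ob (tgt \<beta>') sa)"
      by (rule sum_in_Hom) (use obj g in auto)
    have tr: "\<pi> ?n' (join ?n' p q) = p" "\<sigma> ?n' (join ?n' p q) = q" if "p \<in> ?S" for p q
      using pyramid_nonzero_trunc[OF P(2), of p] that by (auto simp: trunc_join shift_join)
    have hj: "ht (join ?n' p q) = ht b" if "p \<in> ?S" "q \<in> ?Q" for p q
      using hc[of "join ?n' p q"] tr[OF that(1), of q] that ht by (auto simp: level_def)
    have summand: "entry ?\<gamma>' a (join ?n' p q) \<cdot> entry ?\<gamma> (join ?n' p q) b = ?f p \<odot>\<^sub>0\<^bsub>T\<^esub> ?g q"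
      if pq: "p \<in> ?S" "q \<in> ?Q" for p q
    proof -
      have "ht p = ht pb" using pq by (simp add: level_def)
      then have "entry ?\<gamma>' a (join ?n' p q) = entry \<alpha>' pa p \<odot>\<^sub>0\<^bsub>T\<^esub> entry \<beta>' sa q"
        "entry ?\<gamma> (join ?n' p q) b = entry \<alpha> p pb \<odot>\<^sub>0\<^bsub>T\<^esub> entry \<beta> q sb"
        using hj[OF pq] tr[OF pq(1)] ab True by (simp_all add: entry_tensA defs eq\<alpha>[symmetric])
      then show ?thesis using TensA_Comp[OF e[OF pq(1)] e'[OF pq(2)]] by simp
    qed
    have "entry ?R a b = ?\<Sigma> (\<lambda>c. entry ?\<gamma>' a c \<cdot> entry ?\<gamma> c b) ?F"
    proof (rule entry_comp[OF \<gamma> ab])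
      show "finite ?F" using fin by blast
      show "?F \<subseteq> level (ht b)" using hj by (auto simp: level_def)
      fix c assume c: "c \<in> level (ht b) - ?F"
      then have h: "ht c = ht b" by (simp add: level_def)
      show "entry ?\<gamma>' a c \<cdot> entry ?\<gamma> c b = Zero A ?X ?Y"
      proof (cases "ht (\<pi> ?n' c) = ht pb")
        case eq: True
        then have "ht (\<sigma> ?n' c) = ht sb" using hc[of c] ht h by linarith
        moreover have "c = (\<lambda>(p, q). join ?n' p q) (\<pi> ?n' c, \<sigma> ?n' c)" by (simp add: join_trunc_shift)
        then have "(\<pi> ?n' c, \<sigma> ?n' c) \<notin> ?S \<times> ?Q" using c by blast
        ultimately have "ob (tgt \<alpha>) (\<pi> ?n' c) = zero_obj A \<or> ob (tgt \<beta>) (\<sigma> ?n' c) = zero_obj A"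
          using eq by (auto simp: level_def)
        then have "ob (tgt ?\<gamma>) c = zero_obj A"
          using TensO_zero_obj_left[OF obj(5)] TensO_zero_obj_right[OF obj(2)] by (auto simp: tensO_ob)
        then have "entry ?\<gamma> c b = Zero A ?X (ob (tgt ?\<gamma>) c)"
          using Hom_zero_obj_unique[OF entry_in_Hom[OF \<gamma>(1) h] Zero_in_Hom] XY zero_obj_in_Obj by simp
        then show ?thesis
          using Comp_Zero_right[OF entry_in_Hom[OF \<gamma>(2), of a c] XY(1)] h ab \<gamma>(3) by simp
      qed (use vanish[OF h] in blast)
    qed
    also have "\<dots> = ?\<Sigma> (\<lambda>s. entry ?\<gamma>' a ((\<lambda>(p, q). join ?n' p q) s)
        \<cdot> entry ?\<gamma> ((\<lambda>(p, q). join ?n' p q) s) b) (?S \<times> ?Q)"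
    proof (rule sum_reindex[OF XY])
      show "inj_on (\<lambda>(p, q). join ?n' p q) (?S \<times> ?Q)"
      proof (rule inj_onI, clarify)
        fix p q p' q'
        assume "join ?n' p q = join ?n' p' q'" and p: "p \<in> level (ht pb)" "ob (tgt \<alpha>) p \<noteq> zero_obj A"
          "p' \<in> level (ht pb)" "ob (tgt \<alpha>) p' \<noteq> zero_obj A"
        then show "p = p' \<and> q = q'" using tr[of p q] tr[of p' q'] by simp
      qed
    qed (use summand fg in auto)
    also have "\<dots> = ?\<Sigma> (\<lambda>(p, q). ?f p \<odot>\<^sub>0\<^bsub>T\<^esub> ?g q) (?S \<times> ?Q)"
      by (rule sum_cong[OF XY]) (use summand fg in auto)
    also have "\<dots> = ?\<Sigma> (\<lambda>p. ?\<Sigma> (\<lambda>q. ?f p \<odot>\<^sub>0\<^bsub>T\<^esub> ?g q) ?Q) ?S"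
      by (rule sum_Times[OF XY fin fg])
    also have "\<dots> = ?\<Sigma> (\<lambda>p. ?f p \<odot>\<^sub>0\<^bsub>T\<^esub> finprod (Hom_group A (ob (src \<beta>) sb) (ob (tgt \<beta>') sa)) ?g ?Q) ?S"
    proof (rule sum_cong[OF XY])
      fix p assume p: "p \<in> ?S"
      show "?\<Sigma> (\<lambda>q. ?f p \<odot>\<^sub>0\<^bsub>T\<^esub> ?g q) ?Q
        = ?f p \<odot>\<^sub>0\<^bsub>T\<^esub> finprod (Hom_group A (ob (src \<beta>) sb) (ob (tgt \<beta>') sa)) ?g ?Q"
        unfolding X Y by (rule TensA_sum_right[OF f[OF p], symmetric]) (use obj g in auto)
    qed (use TensA_in_Hom[OF f sum_g, folded X Y] in auto)
    also have "\<dots> = finprod (Hom_group A (ob (src \<alpha>) pb) (ob (tgt \<alpha>') pa)) ?f ?S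
        \<odot>\<^sub>0\<^bsub>T\<^esub> finprod (Hom_group A (ob (src \<beta>) sb) (ob (tgt \<beta>') sa)) ?g ?Q"
      unfolding X Y by (rule TensA_sum_left[OF sum_g, symmetric]) (use obj f in auto)
    also have "\<dots> = entry (pyramid_comp A \<alpha>' \<alpha>) pa pb \<odot>\<^sub>0\<^bsub>T\<^esub> entry (pyramid_comp A \<beta>' \<beta>) sa sb"
      by (simp only: entry_comp_support[OF \<alpha> \<alpha>' eq\<alpha> True] entry_comp_support[OF \<beta> \<beta>' eq\<beta> hs])
    also have "\<dots> = entry ?L a b"
      using True by (simp add: entry_tensA[OF ab] defs)
    finally show ?thesis by simp
  qed
qed simp_all

end

theorem proposition4:
  fixes A :: "('o, 'm, 'x) additive_cat_scheme"
    and T :: "('o, 'm, 'y) tensor_structure_scheme"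
  assumes "additive_category A"
    and "strict_monoidal_category A T"
    and "biadditive_tensor A T"
    and unique_zero: "\<And>Z Z'. zero_object A Z \<Longrightarrow> zero_object A Z' \<Longrightarrow> Z = Z'"
  shows "strict_monoidal_category (pyramid_category A) (pyramid_tensor A T)"
proof -
  interpret additive_monoidal_category A T
    using assms
    by (simp add: additive_monoidal_category_def additive_category_unique_zero_def
        additive_category_unique_zero_axioms_def additive_monoidal_category_axioms_def)
  have simps: "Obj (pyramid_category A) = {P. is_pyramid A P}"
    "Arr (pyramid_category A) = {\<alpha>. is_pyramid_mor A \<alpha>}"
    "Ident (pyramid_category A) = pyramid_ident A" "Comp (pyramid_category A) = pyramid_comp A"
    "Unit (pyramid_tensor A T) = pyramid_unit A T" "TensO (pyramid_tensor A T) = pyramid_tensO A T"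
    "TensA (pyramid_tensor A T) = pyramid_tensA A T"
    by (simp_all add: pyramid_category_def pyramid_tensor_def)
  show ?thesis
  proof (intro strict_monoidal_category.intro category_pyramid_category
      strict_monoidal_category_axioms.intro)
  qed (auto simp: simps Hom_pyramid_category unit_pyramid tensO_pyramid tensA_mor tensA_ident
      tensA_comp tensO_assoc tensA_assoc tensO_unit_left tensO_unit_right tensA_unit_left tensA_unit_right)
qed

end
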